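(* Consider the regression framework on $\mathcal{X}=[0,1)$ with $X$ uniform, where $s:[0,1)\to\mathbb{R}$ is differentiable and $C_2>0$ satisfies $|s(t)-s(x)-s'(x)(t-x)|\le C_2(t-x)^2$ for all $t,x\in[0,1)$. Let $\varepsilon\in(0,1/2)$. (1) (Infinite forest, toy model.) There exist a constant $L_1$ depending only on $C_2$ and an integer $n_1$ depending only on $\sigma^2,\varepsilon,\|s\|_\infty,\|s'\|_\infty$ such that for all $n\ge n_1$, $$\inf_{k\in\mathbb{N},\,1/\varepsilon\le k\le n}\int_\varepsilon^{1-\varepsilon}\mathbb{E}\Big[\big(\hat s_{\infty,k}(x;D_n)-s(x)\big)^2\Big]dx\le L_1\Big(\frac{\sigma^2}{n}\Big)^{4/5}.$$ (2) (Single tree, toy model.) Assume in addition $\int_\varepsilon^{1-\varepsilon}(s'(x))^2dx>0$. There exist an integer $k_0\geq 1/\varepsilon$ depending only on $\varepsilon$, $\|s'\|_\infty$, $C_2$ and $\int_\varepsilon^{1-\varepsilon}(s'(x))^2dx$, a constant $L_2>0$ depending only on $s$ and $\varepsilon$, and an integer $n_2$ depending only on $\sigma^2$ and $\varepsilon$, such that for all $n\ge\max(n_2,k_0)$, $$\inf_{k\in\mathbb{N},\,k_0\le k\le n}\int_\varepsilon^{1-\varepsilon}\mathbb{E}\Big[\big(\hat s(x;\mathbb{U}_k;D_n)-s(x)\big)^2\Big]dx\ge L_2\Big(\frac{\sigma^2}{n}\Big)^{2/3},$$ where $\mathbb{U}_k\sim\mathcal{U}_k^{\mathtt{toy}}$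 is independent of $D_n$.
   Context: $D_n=(X_i,Y_i)_{1\le i\le n}$ are independent with common law $P$ such that $X_i$ is uniform on $[0,1)$, $\mathbb{E}[Y_i\mid X_i]=s(X_i)$ and $\mathbb{E}[(Y_i-s(X_i))^2\mid X_i]=\sigma^2>0$. For a finite partition $\mathbb{U}$ of $[0,1)$ the tree (regressogram) estimator is $$\hat s(x;\mathbb{U};D_n)=\sum_{\lambda\in\mathbb{U}}\frac{\sum_{i=1}^nY_i\mathbf{1}_{X_i\in\lambda}}{\operatorname{Card}\{i: X_i\in\lambda\}}\mathbf{1}_{x\in\lambda}\qquad(0/0=0).$$ $\mathbb{U}\sim\mathcal{U}_k^{\mathtt{toy}}$ means $\mathbb{U}=\{[0,\frac{1-T}{k}),[\frac{1-T}{k},\frac{2-T}{k}),\dots,[\frac{k-T}{k},1)\}$ with $T$ uniform over $[0,1)$, independent of $D_n$. The infinite forest estimator is $\hat s_{\infty,k}(x;D_n)=\mathbb{E}_{\mathbb{U}\sim\mathcal{U}_k^{\mathtt{toy}}}[\hat s(x;\mathbb{U};D_n)\mid D_n]$. $\|\cdot\|_\infty$ is the sup-norm on $[0,1)$. *)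

theory Defs
  imports "HOL-Probability.Probability"
begin

definition sup_norm01 :: "(real \<Rightarrow> real) \<Rightarrow> real" where
  "sup_norm01 f = (SUP x\<in>{0..<1}. \<bar>f x\<bar>)"

text \<open>A function on \<open>[0,1)\<close> is encoded as an extensional function, so that equality of
  functions (and measurability) is decided by the values on \<open>[0,1)\<close> alone. The derivative
  at 0 is one-sided.\<close>

definition smooth01 :: "(real \<Rightarrow> real) \<Rightarrow> (real \<Rightarrow> real) \<Rightarrow> real \<Rightarrow> bool" where
  "smooth01 s s' C \<longleftrightarrow>
     s \<in> extensional {0..<1} \<and>
     (\<forall>x\<in>{0..<1}. (s has_real_derivative s' x) (at x within {0..<1})) \<and>
     (\<forall>t\<in>{0..<1}. \<forall>x\<in>{0..<1}. \<bar>s t - s x - s' x * (t - x)\<bar> \<le> C * (t - x)\<^sup>2)"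

definition unif01 :: "real measure" where
  "unif01 = uniform_measure lborel {0..<1}"

text \<open>\<open>P\<close> is the law of a pair \<open>(X, Y) = (fst, snd)\<close>; conditioning on \<open>X\<close> is conditioning on the
  \<open>\<sigma>\<close>-algebra generated by \<open>fst\<close>. Integrability of \<open>Y\<close> is what gives \<open>E[Y | X]\<close> a meaning
  (\<open>real_cond_exp\<close> is total).\<close>

definition regression_law :: "(real \<times> real) measure \<Rightarrow> (real \<Rightarrow> real) \<Rightarrow> real \<Rightarrow> bool" where
  "regression_law P s \<sigma> \<longleftrightarrow>
     prob_space P \<and> sets P = sets (borel \<Otimes>\<^sub>M borel) \<and>
     distr P borel fst = unif01 \<and>
     integrable P snd \<and>
     (AE z in P. real_cond_exp P (vimage_algebra (space P) fst borel) snd z = s (fst z)) \<and>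
     (AE z in P. real_cond_exp P (vimage_algebra (space P) fst borel)
                   (\<lambda>(x, y). (y - s x)\<^sup>2) z = \<sigma>\<^sup>2)"

text \<open>The law of the sample \<open>D\<^sub>n = (X\<^sub>i, Y\<^sub>i)\<close>, \<open>1 \<le> i \<le> n\<close>.\<close>

definition sample_law :: "(real \<times> real) measure \<Rightarrow> nat \<Rightarrow> (nat \<Rightarrow> real \<times> real) measure" where
  "sample_law P n = (\<Pi>\<^sub>M i\<in>{1..n}. P)"

text \<open>Division by zero yields zero, which is the convention \<open>0/0 = 0\<close> for empty cells.\<close>

definition tree_est ::
  "real set set \<Rightarrow> nat \<Rightarrow> (nat \<Rightarrow> real \<times> real) \<Rightarrow> real \<Rightarrow> real" where
  "tree_est U n D x =
     (\<Sum>A\<in>U. (\<Sum>i\<in>{1..n}. snd (D i) * indicator A (fst (D i)))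
               / real (card {i\<in>{1..n}. fst (D i) \<in> A}) * indicator A x)"

text \<open>For \<open>t = 0\<close> the last interval is empty; the empty cell contributes nothing to \<open>tree_est\<close>.\<close>

definition toy_partition :: "nat \<Rightarrow> real \<Rightarrow> real set set" where
  "toy_partition k t =
     {{0 ..< (1 - t) / real k}}
     \<union> (\<lambda>j. {(real j - t) / real k ..< (real j + 1 - t) / real k}) ` {1..<k}
     \<union> {{(real k - t) / real k ..< 1}}"

text \<open>Since the partition is independent of the sample, the conditional expectation given \<open>D\<^sub>n\<close>
  is the integral over the uniform shift for a fixed value of the sample.\<close>

definition forest_est :: "nat \<Rightarrow> nat \<Rightarrow> (nat \<Rightarrow> real \<times> real) \<Rightarrow> real \<Rightarrow> real" where
  "forest_est k n D x = (\<integral>t. tree_est (toy_partition k t) n D x \<partial>unif01)"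

definition forest_risk ::
  "(real \<times> real) measure \<Rightarrow> (real \<Rightarrow> real) \<Rightarrow> real \<Rightarrow> nat \<Rightarrow> nat \<Rightarrow> ennreal" where
  "forest_risk P s \<epsilon> n k =
     (\<integral>\<^sup>+x\<in>{\<epsilon>..1-\<epsilon>}.
        (\<integral>\<^sup>+D. ennreal ((forest_est k n D x - s x)\<^sup>2) \<partial>sample_law P n) \<partial>lborel)"

definition tree_risk ::
  "(real \<times> real) measure \<Rightarrow> (real \<Rightarrow> real) \<Rightarrow> real \<Rightarrow> nat \<Rightarrow> nat \<Rightarrow> ennreal" where
  "tree_risk P s \<epsilon> n k =
     (\<integral>\<^sup>+x\<in>{\<epsilon>..1-\<epsilon>}.
        (\<integral>\<^sup>+(D, t). ennreal ((tree_est (toy_partition k t) n D x - s x)\<^sup>2)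
           \<partial>(sample_law P n \<Otimes>\<^sub>M unif01)) \<partial>lborel)"

end

theory Submission
  imports Defs "HOL-Real_Asymp.Real_Asymp"
begin

text \<open>
  Fix an evaluation point \<open>x\<close> in \<open>[\<epsilon>, 1 - \<epsilon>]\<close> and a shift \<open>t\<close>. As \<open>k \<ge> 1 / \<epsilon>\<close>, the cell \<open>A\<close> of
  \<open>x\<close> is an interval of length exactly \<open>1 / k\<close> inside \<open>[0, 1)\<close>, with midpoint \<open>c\<close>, and the tree
  estimator at \<open>x\<close> is the average of the responses whose design points fall in \<open>A\<close>.

  The stochastic part of the error is an average over \<open>A\<close> of independent terms \<open>g\<close> that are centred
  on \<open>A\<close>. Its mean vanishes, and so do the mixed terms of its second moment, which is therefore
  \<open>n E[1\<^sub>A g\<^sup>2] E[1 / (1 + N)\<^sup>2]\<close> with \<open>N\<close> binomial with parameters \<open>n - 1\<close> and \<open>1 / k\<close>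
  (\<open>expectation_cell_mean_square\<close>). Size biasing bounds the binomial factor from above and Jensen's
  inequality from below. With \<open>v\<close> for the mean of \<open>g\<^sup>2\<close> over the cell, which is \<open>\<sigma>\<^sup>2\<close> plus a term of
  order \<open>1 / k\<^sup>2\<close>, this variance is at most \<open>2 v k / n\<close> and, for \<open>k \<le> n\<close>, at least \<open>v k / (4 n)\<close>.

  The bias is \<open>s' x * (c - x)\<close> up to \<open>C / k\<^sup>2\<close>. Since \<open>c - x\<close> is uniform on an interval of length
  \<open>1 / k\<close> centred at \<open>0\<close> when \<open>t\<close> is uniform, the linear part averages out in the forest
  (\<open>forest_est_minus\<close>), which leaves a squared bias of order \<open>C\<^sup>2 / k ^ 4\<close> (\<open>forest_risk_upper\<close>). For a
  single tree its square has mean \<open>(s' x)\<^sup>2 / (12 k\<^sup>2)\<close>, which after integration over \<open>x\<close> dominates the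
  squared remainder for large \<open>k\<close> (\<open>tree_risk_lower\<close>).

  Balancing \<open>\<sigma>\<^sup>2 k / n\<close> against \<open>1 / k ^ 4\<close> gives the rate \<open>4/5\<close>, and \<open>\<sigma>\<^sup>2 k / n + 1 / k\<^sup>2\<close> is at least of
  order \<open>(\<sigma>\<^sup>2 / n) powr (2/3)\<close> for every \<open>k\<close> (\<open>variance_bias_tradeoff\<close>). The probability that the cell
  is empty is at most \<open>exp (- n / k)\<close>: this is negligible for the forest, and for \<open>k \<le> n\<close> it is below
  \<open>1/2\<close>, which is all that the lower bound needs.
\<close>

section \<open>Reciprocal moments of the binomial law\<close>

lemma binomial_expectation_Suc:
  fixes f :: "nat \<Rightarrow> real"
  assumes p: "p \<in> {0..1}"
  shows "measure_pmf.expectation (binomial_pmf (Suc m) p) f =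
           p * measure_pmf.expectation (binomial_pmf m p) (\<lambda>j. f (Suc j)) +
           (1 - p) * measure_pmf.expectation (binomial_pmf m p) f"
proof -
  have fin: "finite (set_pmf (binomial_pmf m p))" using p by auto
  have "binomial_pmf (Suc m) p = bernoulli_pmf p \<bind>
          (\<lambda>b. map_pmf (\<lambda>k. if b then Suc k else k) (binomial_pmf m p))"
    unfolding binomial_pmf_Suc[OF p] map_pmf_def by (intro bind_pmf_cong) auto
  also have "measure_pmf.expectation \<dots> f =
     (\<Sum>b\<in>UNIV. pmf (bernoulli_pmf p) b *\<^sub>R
        measure_pmf.expectation (map_pmf (\<lambda>k. if b then Suc k else k) (binomial_pmf m p)) f)"
    by (rule pmf_expectation_bind) (use fin in auto)
  finally show ?thesis using p by (simp add: UNIV_bool)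
qed

text \<open>Size biasing: weighting a binomial variable by its value turns it into one plus a binomial
  variable with one trial less.\<close>

lemma binomial_size_bias:
  fixes f :: "nat \<Rightarrow> real"
  assumes p: "p \<in> {0..1}"
  shows "measure_pmf.expectation (binomial_pmf (Suc m) p) (\<lambda>j. real j * f j) =
           real (Suc m) * p * measure_pmf.expectation (binomial_pmf m p) (\<lambda>j. f (Suc j))"
proof (induction m arbitrary: f)
  case 0
  then show ?case using p by (simp add: binomial_expectation_Suc binomial_pmf_0)
next
  case (Suc m)
  let ?E = "\<lambda>m. measure_pmf.expectation (binomial_pmf m p)"
  have split: "?E (Suc m) (\<lambda>j. real (Suc j) * f (Suc j)) =
      ?E (Suc m) (\<lambda>j. f (Suc j)) + ?E (Suc m) (\<lambda>j. real j * f (Suc j))"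
    using p by (subst Bochner_Integration.integral_add[symmetric]) (auto simp: algebra_simps)
  have "?E (Suc (Suc m)) (\<lambda>j. real j * f j) =
      p * ?E (Suc m) (\<lambda>j. f (Suc j)) + p * ?E (Suc m) (\<lambda>j. real j * f (Suc j))
      + (1 - p) * ?E (Suc m) (\<lambda>j. real j * f j)"
    by (subst binomial_expectation_Suc[OF p], subst split) (simp add: algebra_simps)
  also have "\<dots> = p * ?E (Suc m) (\<lambda>j. f (Suc j)) + real (Suc m) * p *
      (p * ?E m (\<lambda>j. f (Suc (Suc j))) + (1 - p) * ?E m (\<lambda>j. f (Suc j)))"
    unfolding Suc.IH by (simp add: algebra_simps)
  also have "\<dots> = real (Suc (Suc m)) * p * ?E (Suc m) (\<lambda>j. f (Suc j))"
    by (subst binomial_expectation_Suc[OF p, of m, symmetric]) (simp add: algebra_simps)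
  finally show ?case .
qed

lemma binomial_expectation_mono:
  fixes f g :: "nat \<Rightarrow> real"
  assumes "p \<in> {0..1}" "\<And>j. f j \<le> g j"
  shows "measure_pmf.expectation (binomial_pmf m p) f \<le> measure_pmf.expectation (binomial_pmf m p) g"
  using assms by (intro integral_mono) auto

lemma binomial_mean:
  assumes p: "p \<in> {0..1}"
  shows "measure_pmf.expectation (binomial_pmf m p) real = real m * p"
proof (cases m)
  case 0
  then show ?thesis using p by (simp add: binomial_pmf_0)
next
  case (Suc k)
  then show ?thesis using binomial_size_bias[OF p, of k "\<lambda>_. 1"] by simp
qed

lemma binomial_prob_0:
  assumes p: "p \<in> {0..1}"
  shows "measure_pmf.expectation (binomial_pmf m p) (\<lambda>j. if j = 0 then 1 else 0) = (1 - p) ^ m"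
  using p by (induction m) (simp_all add: binomial_pmf_0 binomial_expectation_Suc)

lemma binomial_inverse_square_le:
  assumes p: "p \<in> {0..1}" "p > 0"
  shows "measure_pmf.expectation (binomial_pmf m p) (\<lambda>j. 1 / (real j + 1)\<^sup>2)
           \<le> 2 / ((real m + 1) * (real m + 2) * p\<^sup>2)"
proof -
  let ?E = "\<lambda>m. measure_pmf.expectation (binomial_pmf m p)"
  let ?f = "\<lambda>j. 1 / ((real j + 1) * (real j + 2))"
  have "?E m (\<lambda>j. 1 / (real j + 1)\<^sup>2) \<le> ?E m (\<lambda>j. 2 * ?f j)"
  proof (rule binomial_expectation_mono[OF p(1)])
    fix j
    have "(real j + 1) * (real j + 2) \<le> 2 * (real j + 1)\<^sup>2"
      by (simp add: power2_eq_square algebra_simps)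
    then show "1 / (real j + 1)\<^sup>2 \<le> 2 * ?f j" by (simp add: divide_simps)
  qed
  also have "\<dots> = 2 * ?E m ?f" by (rule integral_mult_right_zero)
  finally have 1: "?E m (\<lambda>j. 1 / (real j + 1)\<^sup>2) \<le> 2 * ?E m ?f" .
  have "real (Suc (Suc m)) * p * ?E (Suc m) (\<lambda>j. 1 / real (Suc j))
      = ?E (Suc (Suc m)) (\<lambda>j. real j * (1 / real j))"
    by (rule binomial_size_bias[OF p(1), symmetric])
  also have "\<dots> \<le> ?E (Suc (Suc m)) (\<lambda>j. 1)"
    by (rule binomial_expectation_mono[OF p(1)]) auto
  finally have 2: "(real m + 2) * p * ?E (Suc m) (\<lambda>j. 1 / real (Suc j)) \<le> 1"
    by (simp add: algebra_simps)
  have "real (Suc m) * p * ?E m (\<lambda>j. 1 / (real (Suc j) * (real (Suc j) + 1)))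
      = ?E (Suc m) (\<lambda>j. real j * (1 / (real j * (real j + 1))))"
    by (rule binomial_size_bias[OF p(1), symmetric])
  also have "\<dots> \<le> ?E (Suc m) (\<lambda>j. 1 / real (Suc j))"
    by (rule binomial_expectation_mono[OF p(1)]) (auto simp: divide_simps)
  finally have 3: "(real m + 1) * p * ?E m ?f \<le> ?E (Suc m) (\<lambda>j. 1 / real (Suc j))"
    by (simp add: algebra_simps)
  have "(real m + 2) * p * ((real m + 1) * p * ?E m ?f)
      \<le> (real m + 2) * p * ?E (Suc m) (\<lambda>j. 1 / real (Suc j))"
    using 3 p by (intro mult_left_mono) auto
  then have "((real m + 1) * (real m + 2) * p\<^sup>2) * ?E m ?f \<le> 1"
    using 2 by (simp add: power2_eq_square mult_ac)
  moreover have "(real m + 1) * (real m + 2) * p\<^sup>2 > 0"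
    using p by (auto intro!: mult_pos_pos)
  ultimately have "?E m ?f \<le> 1 / ((real m + 1) * (real m + 2) * p\<^sup>2)"
    by (simp add: pos_le_divide_eq mult.commute)
  then show ?thesis using 1 by simp
qed

lemma inverse_square_tangent:
  fixes c y :: real
  assumes "c > 0" "y > 0"
  shows "3 / c\<^sup>2 - 2 * y / c ^ 3 \<le> 1 / y\<^sup>2"
proof -
  have "0 \<le> (y - c)\<^sup>2 * (2 * y + c)" using assms by simp
  then have "3 * c * y\<^sup>2 - 2 * y ^ 3 \<le> c ^ 3"
    by (simp add: power2_eq_square power3_eq_cube algebra_simps)
  then have "(3 * c * y\<^sup>2 - 2 * y ^ 3) / (c ^ 3 * y\<^sup>2) \<le> c ^ 3 / (c ^ 3 * y\<^sup>2)"
    using assms by (intro divide_right_mono) auto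
  moreover have "(3 * c * y\<^sup>2 - 2 * y ^ 3) / (c ^ 3 * y\<^sup>2) = 3 / c\<^sup>2 - 2 * y / c ^ 3"
    using assms by (simp add: diff_divide_distrib power2_eq_square power3_eq_cube)
  ultimately show ?thesis using assms by simp
qed

text \<open>Jensen's inequality for the convex function \<open>1 / y\<^sup>2\<close>, through its tangent at the mean.\<close>

lemma binomial_inverse_square_ge:
  assumes p: "p \<in> {0..1}"
  shows "1 / (real m * p + 1)\<^sup>2 \<le> measure_pmf.expectation (binomial_pmf m p) (\<lambda>j. 1 / (real j + 1)\<^sup>2)"
proof -
  let ?E = "\<lambda>m. measure_pmf.expectation (binomial_pmf m p)"
  define c where "c = real m * p + 1"
  have c: "c > 0" using p by (auto simp: c_def intro!: add_nonneg_pos)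
  have "?E m (\<lambda>j. 3 / c\<^sup>2 - 2 / c ^ 3 - 2 / c ^ 3 * real j) = 3 / c\<^sup>2 - 2 / c ^ 3 - 2 / c ^ 3 * (real m * p)"
    using p by (subst Bochner_Integration.integral_diff)
      (auto simp: binomial_mean simp del: of_nat_Suc)
  also have "\<dots> = 3 / c\<^sup>2 - 2 / c ^ 3 * c" by (simp add: c_def algebra_simps add_divide_distrib)
  also have "\<dots> = 1 / c\<^sup>2" using c by (simp add: power2_eq_square power3_eq_cube)
  finally have "1 / c\<^sup>2 = ?E m (\<lambda>j. 3 / c\<^sup>2 - 2 / c ^ 3 - 2 / c ^ 3 * real j)" ..
  also have "\<dots> \<le> ?E m (\<lambda>j. 1 / (real j + 1)\<^sup>2)"
  proof (rule binomial_expectation_mono[OF p])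
    fix j show "3 / c\<^sup>2 - 2 / c ^ 3 - 2 / c ^ 3 * real j \<le> 1 / (real j + 1)\<^sup>2"
      using inverse_square_tangent[OF c, of "real j + 1"] by (simp add: algebra_simps add_divide_distrib)
  qed
  finally show ?thesis by (simp add: c_def)
qed

section \<open>The average over the sample points in a cell\<close>

text \<open>The number of the points \<open>D i\<close>, \<open>i \<in> I\<close>, that fall in \<open>B\<close>.\<close>

definition cell_count :: "'a set \<Rightarrow> 'i set \<Rightarrow> ('i \<Rightarrow> 'a) \<Rightarrow> nat" where
  "cell_count B I D = card {i\<in>I. D i \<in> B}"

text \<open>The average of \<open>g\<close> over these points; it is \<open>0\<close> if there are none.\<close>

definition cell_mean :: "'a set \<Rightarrow> 'i set \<Rightarrow> ('a \<Rightarrow> real) \<Rightarrow> ('i \<Rightarrow> 'a) \<Rightarrow> real" where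
  "cell_mean B I g D = (\<Sum>i\<in>I. indicator B (D i) * g (D i)) / real (cell_count B I D)"

lemma cell_count_eq_sum: "finite I \<Longrightarrow> cell_count B I D = (\<Sum>i\<in>I. if D i \<in> B then 1 else 0)"
  by (simp add: cell_count_def sum.If_cases Int_def)

lemma cell_count_insert_upd:
  assumes "finite I" "i \<notin> I"
  shows "cell_count B (insert i I) (D(i := y)) = (if y \<in> B then Suc (cell_count B I D) else cell_count B I D)"
proof -
  have "(\<Sum>j\<in>I. if (D(i := y)) j \<in> B then 1 else 0) = (\<Sum>j\<in>I. if D j \<in> B then 1 else (0::nat))"
    using assms by (intro sum.cong) auto
  then show ?thesis using assms by (simp add: cell_count_eq_sum)
qed

lemma cell_count_upd_notin: "i \<notin> I \<Longrightarrow> cell_count B I (D(i := y)) = cell_count B I D"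
  unfolding cell_count_def by (rule arg_cong[of _ _ card]) auto

lemma cell_count_insert:
  assumes "finite I" "i \<notin> I"
  shows "cell_count B (insert i I) D = (if D i \<in> B then Suc (cell_count B I D) else cell_count B I D)"
  using assms by (simp add: cell_count_eq_sum)

lemma cell_count_le: "finite I \<Longrightarrow> cell_count B I D \<le> card I"
  unfolding cell_count_def by (rule card_mono) auto

lemma cell_mean_empty:
  assumes "finite I" "cell_count B I D = 0"
  shows "cell_mean B I g D = 0"
  using assms by (simp add: cell_mean_def)

lemma cell_mean_const:
  assumes "finite I"
  shows "cell_mean B I (\<lambda>_. c) D = (if cell_count B I D = 0 then 0 else c)"
proof -
  have "(\<Sum>i\<in>I. indicator B (D i) * c) = real (cell_count B I D) * c"
    unfolding cell_count_eq_sum[OF assms] of_nat_sum sum_distrib_right by (intro sum.cong) auto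
  then show ?thesis by (simp add: cell_mean_def)
qed

lemma cell_mean_add: "cell_mean B I (\<lambda>z. f z + g z) D = cell_mean B I f D + cell_mean B I g D"
  by (simp add: cell_mean_def algebra_simps sum.distrib add_divide_distrib)

lemma cell_mean_mono:
  assumes "finite I" "\<And>z. z \<in> B \<Longrightarrow> f z \<le> g z"
  shows "cell_mean B I f D \<le> cell_mean B I g D"
  unfolding cell_mean_def using assms
  by (intro divide_right_mono sum_mono) (auto simp: indicator_def)

lemma cell_mean_abs_le:
  assumes "finite I" "\<And>z. z \<in> B \<Longrightarrow> \<bar>f z\<bar> \<le> c" "c \<ge> 0"
  shows "\<bar>cell_mean B I f D\<bar> \<le> c"
proof -
  have "cell_mean B I f D \<le> cell_mean B I (\<lambda>_. c) D"
    using assms by (intro cell_mean_mono) (auto simp: abs_le_iff)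
  moreover have "cell_mean B I (\<lambda>_. - c) D \<le> cell_mean B I f D"
    using assms by (intro cell_mean_mono) (auto simp: abs_le_iff minus_le_iff)
  ultimately show ?thesis using assms by (auto simp: cell_mean_const split: if_splits)
qed

lemma measurable_cell_count [measurable]:
  assumes [measurable]: "B \<in> sets M" and "finite I" "I \<subseteq> J"
  shows "cell_count B I \<in> measurable (Pi\<^sub>M J (\<lambda>_. M)) (count_space UNIV)"
proof -
  have [measurable]: "(\<lambda>D. D i) \<in> measurable (Pi\<^sub>M J (\<lambda>_. M)) M" if "i \<in> I" for i
    using that assms(3) by (intro measurable_component_singleton) auto
  have "cell_count B I = (\<lambda>D. \<Sum>i\<in>I. if D i \<in> B then 1 else 0)"
    using assms(2) by (auto simp: cell_count_eq_sum)
  then show ?thesis by simp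
qed

context prob_space
begin

lemma integral_PiM_split_coordinate:
  fixes u :: "'a \<Rightarrow> real" and H :: "('i \<Rightarrow> 'a) \<Rightarrow> real"
  assumes "finite I" "i \<in> I"
    and "integrable (Pi\<^sub>M I (\<lambda>_. M)) (\<lambda>D. u (D i) * H D)"
    and H: "\<And>D y. H (D(i := y)) = H D"
  shows "(\<integral>D. u (D i) * H D \<partial>Pi\<^sub>M I (\<lambda>_. M)) = (\<integral>y. u y \<partial>M) * (\<integral>D. H D \<partial>Pi\<^sub>M (I - {i}) (\<lambda>_. M))"
proof -
  interpret product_sigma_finite "\<lambda>_. M" by unfold_locales
  have I: "insert i (I - {i}) = I" using assms by auto
  have "(\<integral>D. u (D i) * H D \<partial>Pi\<^sub>M I (\<lambda>_. M)) =
      (\<integral>D. (\<integral>y. u ((D(i:=y)) i) * H (D(i:=y)) \<partial>M) \<partial>Pi\<^sub>M (I - {i}) (\<lambda>_. M))"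
    using product_integral_insert[of "I - {i}" i "\<lambda>D. u (D i) * H D"] assms I by simp
  also have "\<dots> = (\<integral>D. (\<integral>y. u y \<partial>M) * H D \<partial>Pi\<^sub>M (I - {i}) (\<lambda>_. M))"
    by (simp add: H)
  finally show ?thesis by simp
qed

lemma integrable_PiM_component:
  fixes u :: "'a \<Rightarrow> real"
  assumes "integrable M u" "i \<in> I"
  shows "integrable (Pi\<^sub>M I (\<lambda>_. M)) (\<lambda>D. u (D i))"
proof -
  have "integrable (distr (Pi\<^sub>M I (\<lambda>_. M)) M (\<lambda>D. D i)) u"
    using assms by (subst distr_PiM_component) (auto intro: prob_space_axioms)
  then show ?thesis using assms by (subst (asm) integrable_distr_eq) auto
qed

lemma integrable_cell_count_fun:
  fixes f :: "nat \<Rightarrow> real"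
  assumes [measurable]: "B \<in> sets M" and I: "finite I" "J \<subseteq> I"
  shows "integrable (Pi\<^sub>M I (\<lambda>_. M)) (\<lambda>D. f (cell_count B J D))"
proof -
  interpret product_sigma_finite "\<lambda>_. M" by unfold_locales
  interpret PI: prob_space "Pi\<^sub>M I (\<lambda>_. M)" by (intro prob_space_PiM prob_space_axioms)
  have J: "finite J" using I by (rule rev_finite_subset)
  note [measurable] = measurable_cell_count[OF assms(1) J I(2)]
  show ?thesis
  proof (rule PI.integrable_const_bound[where B = "\<Sum>j\<le>card J. \<bar>f j\<bar>"])
    show "AE D in Pi\<^sub>M I (\<lambda>_. M). norm (f (cell_count B J D)) \<le> (\<Sum>j\<le>card J. \<bar>f j\<bar>)"
    proof (rule AE_I2)
      fix D
      show "norm (f (cell_count B J D)) \<le> (\<Sum>j\<le>card J. \<bar>f j\<bar>)"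
        using cell_count_le[OF J, of B D] by (auto intro!: member_le_sum)
    qed
    have "(\<lambda>D. f (cell_count B J D)) = f \<circ> cell_count B J" by auto
    then show "(\<lambda>D. f (cell_count B J D)) \<in> borel_measurable (Pi\<^sub>M I (\<lambda>_. M))" by simp
  qed
qed

lemma expectation_cell_count:
  fixes f :: "nat \<Rightarrow> real"
  assumes B [measurable]: "B \<in> sets M" and "finite I"
  shows "(\<integral>D. f (cell_count B I D) \<partial>Pi\<^sub>M I (\<lambda>_. M)) =
           measure_pmf.expectation (binomial_pmf (card I) (prob B)) f"
  using \<open>finite I\<close>
proof (induction I arbitrary: f)
  case empty
  interpret product_sigma_finite "\<lambda>_. M" by unfold_locales
  show ?case by (simp add: cell_count_def binomial_pmf_0 PiM_empty lebesgue_integral_count_space_finite)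
next
  case (insert i I)
  interpret product_sigma_finite "\<lambda>_. M" by unfold_locales
  interpret PI: prob_space "Pi\<^sub>M I (\<lambda>_. M)" by (intro prob_space_PiM prob_space_axioms)
  have "(\<integral>D. f (cell_count B (insert i I) D) \<partial>Pi\<^sub>M (insert i I) (\<lambda>_. M)) =
      (\<integral>D. (\<integral>y. f (cell_count B (insert i I) (D(i := y))) \<partial>M) \<partial>Pi\<^sub>M I (\<lambda>_. M))"
    using insert by (intro product_integral_insert integrable_cell_count_fun) auto
  also have "\<dots> = (\<integral>D. prob B * f (Suc (cell_count B I D)) + (1 - prob B) * f (cell_count B I D) \<partial>Pi\<^sub>M I (\<lambda>_. M))"
  proof (rule Bochner_Integration.integral_cong[OF refl])
    fix D
    let ?a = "f (Suc (cell_count B I D))" and ?b = "f (cell_count B I D)"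
    have "(\<integral>y. f (cell_count B (insert i I) (D(i := y))) \<partial>M) = (\<integral>y. (?a - ?b) * indicator B y + ?b \<partial>M)"
      using insert by (intro Bochner_Integration.integral_cong) (auto simp: cell_count_insert_upd)
    also have "\<dots> = (?a - ?b) * prob B + ?b"
      by (subst Bochner_Integration.integral_add) (auto simp: prob_space less_top[symmetric] simp del: left_diff_distrib)
    also have "\<dots> = prob B * ?a + (1 - prob B) * ?b"
      by (simp add: algebra_simps)
    finally show "(\<integral>y. f (cell_count B (insert i I) (D(i := y))) \<partial>M) = prob B * ?a + (1 - prob B) * ?b" .
  qed
  also have "\<dots> = prob B * (\<integral>D. f (Suc (cell_count B I D)) \<partial>Pi\<^sub>M I (\<lambda>_. M)) +
      (1 - prob B) * (\<integral>D. f (cell_count B I D) \<partial>Pi\<^sub>M I (\<lambda>_. M))"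
    using insert integrable_cell_count_fun[OF B insert(1) subset_refl, of f]
      integrable_cell_count_fun[OF B insert(1) subset_refl, of "\<lambda>j. f (Suc j)"]
    by (subst Bochner_Integration.integral_add) auto
  also have "\<dots> = measure_pmf.expectation (binomial_pmf (card (insert i I)) (prob B)) f"
    using insert by (simp add: insert.IH[of f] insert.IH[of "\<lambda>j. f (Suc j)"] binomial_expectation_Suc)
  finally show ?case .
qed

text \<open>If \<open>g\<close> is centred on the cell, then its cell average has mean zero, and the products of distinct
  observations do not contribute to the second moment: given that \<open>D i\<close> and \<open>D j\<close> lie in the cell,
  the number of points in it depends on the other observations only.\<close>

lemma
  assumes B [measurable]: "B \<in> sets M" and g [measurable]: "g \<in> borel_measurable M"
    and I: "finite I"
    and sq: "integrable M (\<lambda>y. indicator B y * (g y)\<^sup>2)"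
    and centred: "(\<integral>y. indicator B y * g y \<partial>M) = 0"
  shows integrable_cell_mean: "integrable (Pi\<^sub>M I (\<lambda>_. M)) (cell_mean B I g)"
    and expectation_cell_mean: "(\<integral>D. cell_mean B I g D \<partial>Pi\<^sub>M I (\<lambda>_. M)) = 0"
    and integrable_cell_mean_square: "integrable (Pi\<^sub>M I (\<lambda>_. M)) (\<lambda>D. (cell_mean B I g D)\<^sup>2)"
    and expectation_cell_mean_square:
      "(\<integral>D. (cell_mean B I g D)\<^sup>2 \<partial>Pi\<^sub>M I (\<lambda>_. M)) =
         real (card I) * (\<integral>y. indicator B y * (g y)\<^sup>2 \<partial>M) *
         measure_pmf.expectation (binomial_pmf (card I - 1) (prob B)) (\<lambda>j. 1 / (real j + 1)\<^sup>2)"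
proof -
  let ?PI = "Pi\<^sub>M I (\<lambda>_. M)"
  interpret product_sigma_finite "\<lambda>_. M" by unfold_locales
  interpret PI: prob_space "?PI" by (intro prob_space_PiM prob_space_axioms)
  define u where "u = (\<lambda>y. indicator B y * g y)"
  define N where "N = cell_count B I"
  have [measurable]: "u \<in> borel_measurable M" unfolding u_def by measurable
  have [measurable]: "N \<in> measurable ?PI (count_space UNIV)"
    unfolding N_def using I by (intro measurable_cell_count) auto
  have comp [measurable]: "(\<lambda>D. D i) \<in> measurable ?PI M" if "i \<in> I" for i
    using that by (rule measurable_component_singleton)
  have usq: "(u y)\<^sup>2 = indicator B y * (g y)\<^sup>2" for y by (auto simp: u_def indicator_def)
  have u0: "(\<integral>y. u y \<partial>M) = 0" using centred by (simp add: u_def)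
  have iu2: "integrable ?PI (\<lambda>D. (u (D i))\<^sup>2)" if "i \<in> I" for i
    using sq that by (intro integrable_PiM_component[where u = "\<lambda>y. (u y)\<^sup>2"]) (auto simp: usq)
  have Npos: "N D \<ge> 1" if "i \<in> I" "u (D i) \<noteq> 0" for D i
  proof -
    have "D i \<in> B" using that by (auto simp: u_def indicator_def split: if_splits)
    then have "i \<in> {i\<in>I. D i \<in> B}" using that by auto
    then show ?thesis unfolding N_def cell_count_def using I
      by (metis (no_types, lifting) One_nat_def Suc_leI card_gt_0_iff empty_iff finite_Collect_conjI finite_subset mem_Collect_eq subsetI)
  qed
  have cm: "cell_mean B I g D = (\<Sum>i\<in>I. u (D i) / real (N D))" for D
    by (simp add: cell_mean_def u_def N_def sum_divide_distrib)
  have remove: "N D = (if D i \<in> B then Suc (cell_count B (I - {i}) D) else cell_count B (I - {i}) D)"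
    if "i \<in> I" for i D
    using cell_count_insert[of "I - {i}" i B D] I that by (simp add: N_def insert_absorb)
  have in1: "integrable ?PI (\<lambda>D. u (D i) / real (N D))" if "i \<in> I" for i
  proof (rule Bochner_Integration.integrable_bound)
    show "integrable ?PI (\<lambda>D. 1 + (u (D i))\<^sup>2)" using iu2[OF that] by simp
    show "(\<lambda>D. u (D i) / real (N D)) \<in> borel_measurable ?PI" using that by measurable
    show "AE D in ?PI. norm (u (D i) / real (N D)) \<le> norm (1 + (u (D i))\<^sup>2)"
    proof (rule AE_I2)
      fix D
      have "\<bar>u (D i)\<bar> \<le> 1 + (u (D i))\<^sup>2"
        using sum_squares_bound[of 1 "\<bar>u (D i)\<bar>"] by simp
      moreover have "\<bar>u (D i)\<bar> / real (N D) \<le> \<bar>u (D i)\<bar>"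
        using Npos[OF that, of D] by (cases "u (D i) = 0") (auto simp: divide_simps intro!: mult_left_mono)
      ultimately show "norm (u (D i) / real (N D)) \<le> norm (1 + (u (D i))\<^sup>2)" by simp
    qed
  qed
  have in2: "integrable ?PI (\<lambda>D. (u (D i) / real (N D)) * (u (D j) / real (N D)))" if "i \<in> I" "j \<in> I" for i j
  proof (rule Bochner_Integration.integrable_bound)
    show "integrable ?PI (\<lambda>D. (u (D i))\<^sup>2 + (u (D j))\<^sup>2)" using iu2 that by simp
    show "(\<lambda>D. (u (D i) / real (N D)) * (u (D j) / real (N D))) \<in> borel_measurable ?PI"
      using that by measurable
    show "AE D in ?PI. norm ((u (D i) / real (N D)) * (u (D j) / real (N D))) \<le> norm ((u (D i))\<^sup>2 + (u (D j))\<^sup>2)"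
    proof (rule AE_I2)
      fix D
      have le: "\<bar>u (D i) / real (N D)\<bar> \<le> \<bar>u (D i)\<bar>" if "i \<in> I" for i
        using Npos[OF that, of D] by (cases "u (D i) = 0") (auto simp: divide_simps intro!: mult_left_mono)
      have "\<bar>u (D i) / real (N D)\<bar> * \<bar>u (D j) / real (N D)\<bar> \<le> \<bar>u (D i)\<bar> * \<bar>u (D j)\<bar>"
        using le that by (intro mult_mono) auto
      also have "\<dots> \<le> (u (D i))\<^sup>2 + (u (D j))\<^sup>2"
        using sum_squares_bound[of "\<bar>u (D i)\<bar>" "\<bar>u (D j)\<bar>"] by (simp add: mult.assoc)
           (use mult_nonneg_nonneg[of "\<bar>u (D i)\<bar>" "\<bar>u (D j)\<bar>"] in linarith)
      finally show "norm ((u (D i) / real (N D)) * (u (D j) / real (N D))) \<le> norm ((u (D i))\<^sup>2 + (u (D j))\<^sup>2)"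
        by (simp add: abs_mult)
    qed
  qed
  have int1: "(\<integral>D. u (D i) / real (N D) \<partial>?PI) = 0" if i: "i \<in> I" for i
  proof -
    define H where "H D = 1 / (real (cell_count B (I - {i}) D) + 1)" for D
    have eq: "u (D i) / real (N D) = u (D i) * H D" for D
      using remove[OF i, of D] by (auto simp: u_def H_def indicator_def)
    have "(\<integral>D. u (D i) * H D \<partial>?PI) = (\<integral>y. u y \<partial>M) * (\<integral>D. H D \<partial>Pi\<^sub>M (I - {i}) (\<lambda>_. M))"
    proof (rule integral_PiM_split_coordinate[OF I i])
      show "integrable ?PI (\<lambda>D. u (D i) * H D)" using in1[OF i] by (simp add: eq)
      show "H (D(i := y)) = H D" for D y by (simp add: H_def cell_count_upd_notin)
    qed
    then show ?thesis unfolding eq u0 by simp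
  qed
  have cross: "(\<integral>D. (u (D i) / real (N D)) * (u (D j) / real (N D)) \<partial>?PI) = 0"
    if i: "i \<in> I" and j: "j \<in> I" and ij: "i \<noteq> j" for i j
  proof -
    define H where "H D = u (D j) / (real (cell_count B (I - {i}) D) + 1)\<^sup>2" for D
    have eq: "(u (D i) / real (N D)) * (u (D j) / real (N D)) = u (D i) * H D" for D
      using remove[OF i, of D] by (auto simp: u_def H_def indicator_def power2_eq_square add.commute)
    have "(\<integral>D. u (D i) * H D \<partial>?PI) = (\<integral>y. u y \<partial>M) * (\<integral>D. H D \<partial>Pi\<^sub>M (I - {i}) (\<lambda>_. M))"
    proof (rule integral_PiM_split_coordinate[OF I i])
      show "integrable ?PI (\<lambda>D. u (D i) * H D)" using in2[OF i j] unfolding eq .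
      show "H (D(i := y)) = H D" for D y using ij by (simp add: H_def cell_count_upd_notin)
    qed
    then show ?thesis unfolding eq u0 by simp
  qed
  let ?R = "measure_pmf.expectation (binomial_pmf (card I - 1) (prob B)) (\<lambda>j. 1 / (real j + 1)\<^sup>2)"
  have diag: "(\<integral>D. (u (D i) / real (N D)) * (u (D i) / real (N D)) \<partial>?PI) = (\<integral>y. (u y)\<^sup>2 \<partial>M) * ?R"
    if i: "i \<in> I" for i
  proof -
    define H where "H D = 1 / (real (cell_count B (I - {i}) D) + 1)\<^sup>2" for D
    have eq: "(u (D i) / real (N D)) * (u (D i) / real (N D)) = (u (D i))\<^sup>2 * H D" for D
      using remove[OF i, of D] by (auto simp: u_def H_def indicator_def power2_eq_square add.commute)
    have "(\<integral>D. (u (D i))\<^sup>2 * H D \<partial>?PI) = (\<integral>y. (u y)\<^sup>2 \<partial>M) * (\<integral>D. H D \<partial>Pi\<^sub>M (I - {i}) (\<lambda>_. M))"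
    proof (rule integral_PiM_split_coordinate[OF I i])
      show "integrable ?PI (\<lambda>D. (u (D i))\<^sup>2 * H D)" using in2[OF i i] unfolding eq .
      show "H (D(i := y)) = H D" for D y by (simp add: H_def cell_count_upd_notin)
    qed
    also have "(\<integral>D. H D \<partial>Pi\<^sub>M (I - {i}) (\<lambda>_. M)) = ?R"
      unfolding H_def using I i
      by (subst expectation_cell_count[OF B, of _ "\<lambda>j. 1 / (real j + 1)\<^sup>2"]) auto
    finally show ?thesis unfolding eq .
  qed
  show "integrable ?PI (cell_mean B I g)"
    using in1 I by (subst cm[abs_def]) auto
  show "(\<integral>D. cell_mean B I g D \<partial>?PI) = 0"
    unfolding cm using in1 int1 by (subst Bochner_Integration.integral_sum) auto
  have cm2: "(cell_mean B I g D)\<^sup>2 = (\<Sum>i\<in>I. \<Sum>j\<in>I. (u (D i) / real (N D)) * (u (D j) / real (N D)))" for D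
    by (simp add: cm power2_eq_square sum_product)
  show "integrable ?PI (\<lambda>D. (cell_mean B I g D)\<^sup>2)"
    unfolding cm2 using in2 by auto
  have "(\<integral>D. (cell_mean B I g D)\<^sup>2 \<partial>?PI) =
      (\<Sum>i\<in>I. \<Sum>j\<in>I. (\<integral>D. (u (D i) / real (N D)) * (u (D j) / real (N D)) \<partial>?PI))"
    unfolding cm2 using in2 by (subst Bochner_Integration.integral_sum, force)
      (intro sum.cong refl Bochner_Integration.integral_sum, auto)
  also have "\<dots> = (\<Sum>i\<in>I. \<Sum>j\<in>I. if j = i then (\<integral>y. (u y)\<^sup>2 \<partial>M) * ?R else 0)"
    using cross diag by (intro sum.cong) auto
  also have "\<dots> = real (card I) * (\<integral>y. (u y)\<^sup>2 \<partial>M) * ?R"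
    using I by simp
  finally show "(\<integral>D. (cell_mean B I g D)\<^sup>2 \<partial>?PI) = real (card I) * (\<integral>y. indicator B y * (g y)\<^sup>2 \<partial>M) * ?R"
    by (simp add: usq)
qed

lemma prob_cell_count_0:
  assumes "B \<in> sets M" "finite I"
  shows "(\<integral>D. (if cell_count B I D = 0 then 1 else 0) \<partial>Pi\<^sub>M I (\<lambda>_. M)) = (1 - prob B) ^ card I"
  using expectation_cell_count[OF assms, of "\<lambda>j. if j = 0 then 1 else 0"] by (simp add: binomial_prob_0)

end

section \<open>Smooth regression functions\<close>

lemma smooth01_continuous:
  assumes "smooth01 s s' C"
  shows "continuous_on {0..<1} s"
  using assms unfolding smooth01_def
  by (auto simp: continuous_on_eq_continuous_within intro: DERIV_continuous)

lemma smooth01_taylor: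
  assumes "smooth01 s s' C" "t \<in> {0..<1}" "x \<in> {0..<1}"
  shows "\<bar>s t - s x - s' x * (t - x)\<bar> \<le> C * (t - x)\<^sup>2"
  using assms unfolding smooth01_def by blast

lemma smooth01_measurable:
  assumes "smooth01 s s' C"
  shows "s \<in> borel_measurable borel"
proof -
  have "(\<lambda>x. indicator {0..<1} x *\<^sub>R s x) \<in> borel_measurable borel"
    by (intro borel_measurable_continuous_on_indicator smooth01_continuous[OF assms]) auto
  then have "(\<lambda>x. indicator {0..<1} x *\<^sub>R s x + indicator (- {0..<1}) x *\<^sub>R undefined) \<in> borel_measurable borel"
    by measurable
  also have "(\<lambda>x. indicator {0..<1} x *\<^sub>R s x + indicator (- {0..<1}) x *\<^sub>R undefined) = s"
    using assms by (auto simp: fun_eq_iff indicator_def smooth01_def extensional_def)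
  finally show ?thesis .
qed

text \<open>Adding the Taylor estimates at \<open>x\<close> and at \<open>t\<close> bounds the increment of the derivative.\<close>

lemma smooth01_deriv_lipschitz:
  assumes "smooth01 s s' C" "t \<in> {0..<1}" "x \<in> {0..<1}"
  shows "\<bar>s' t - s' x\<bar> \<le> 2 * C * \<bar>t - x\<bar>"
proof (cases "t = x")
  case False
  have "\<bar>(s' t - s' x) * (t - x)\<bar> \<le> 2 * C * (t - x)\<^sup>2"
    using smooth01_taylor[OF assms] smooth01_taylor[OF assms(1,3,2)]
    by (simp add: power2_commute[of x t] algebra_simps)
  then have "\<bar>s' t - s' x\<bar> * \<bar>t - x\<bar> \<le> (2 * C * \<bar>t - x\<bar>) * \<bar>t - x\<bar>"
    by (simp add: abs_mult power2_eq_square mult.assoc abs_mult_self_eq)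
  then show ?thesis using False by simp
qed auto

lemma smooth01_nonneg:
  assumes "smooth01 s s' C"
  shows "C \<ge> 0"
  using smooth01_deriv_lipschitz[OF assms, of 0 "1/2"] by simp

lemma smooth01_deriv_continuous:
  assumes "smooth01 s s' C"
  shows "continuous_on {0..<1} s'"
proof -
  have "(2 * C)-lipschitz_on {0..<1} s'"
    using smooth01_nonneg[OF assms] smooth01_deriv_lipschitz[OF assms]
    by (intro lipschitz_onI) (auto simp: dist_real_def)
  then show ?thesis by (rule lipschitz_on_continuous_on)
qed

lemma abs_le_sup_norm01:
  assumes "bdd_above ((\<lambda>x. \<bar>f x\<bar>) ` {0..<1})" "x \<in> {0..<1}"
  shows "\<bar>f x\<bar> \<le> sup_norm01 f"
  unfolding sup_norm01_def using assms by (intro cSUP_upper)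

lemma smooth01_deriv_le:
  assumes "smooth01 s s' C" "x \<in> {0..<1}"
  shows "\<bar>s' x\<bar> \<le> sup_norm01 s'"
proof (rule abs_le_sup_norm01[OF _ assms(2)], rule bdd_aboveI2)
  fix y :: real assume y: "y \<in> {0..<1}"
  have "\<bar>s' y - s' 0\<bar> \<le> 2 * C * \<bar>y - 0\<bar>" using y by (intro smooth01_deriv_lipschitz[OF assms(1)]) auto
  also have "\<dots> \<le> 2 * C * 1" using y smooth01_nonneg[OF assms(1)] by (intro mult_left_mono) auto
  finally show "\<bar>s' y\<bar> \<le> 2 * C + \<bar>s' 0\<bar>" by simp
qed

lemma smooth01_le:
  assumes "smooth01 s s' C" "x \<in> {0..<1}"
  shows "\<bar>s x\<bar> \<le> sup_norm01 s"
proof (rule abs_le_sup_norm01[OF _ assms(2)], rule bdd_aboveI2)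
  fix y :: real assume y: "y \<in> {0..<1}"
  have "\<bar>s y - s 0 - s' 0 * (y - 0)\<bar> \<le> C * (y - 0)\<^sup>2" using y by (intro smooth01_taylor[OF assms(1)]) auto
  moreover have "C * (y - 0)\<^sup>2 \<le> C * 1"
    using y smooth01_nonneg[OF assms(1)] by (intro mult_left_mono) (auto simp: power_le_one)
  moreover have "\<bar>s' 0 * (y - 0)\<bar> \<le> \<bar>s' 0\<bar>"
    using y by (auto simp: abs_mult intro!: mult_left_le)
  ultimately show "\<bar>s y\<bar> \<le> C + \<bar>s' 0\<bar> + \<bar>s 0\<bar>" by linarith
qed

section \<open>Moments of the regression model\<close>

lemma sets_unif01 [measurable_cong, simp]: "sets unif01 = sets borel"
  by (simp add: unif01_def)

lemma space_unif01 [simp]: "space unif01 = UNIV"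
  by (simp add: unif01_def)

lemma prob_space_unif01: "prob_space unif01"
  unfolding unif01_def by (rule prob_space_uniform_measure) auto

lemma AE_unif01: "AE x in unif01. x \<in> {0..<1}"
  unfolding unif01_def by (rule AE_uniform_measureI) auto

lemma unif01_density: "unif01 = density lborel (\<lambda>x. ennreal (indicator {0..<1} x))"
  unfolding unif01_def uniform_measure_def by (intro density_cong) (auto simp: indicator_def)

lemma integral_unif01:
  fixes f :: "real \<Rightarrow> real"
  assumes [measurable]: "f \<in> borel_measurable borel"
  shows "(\<integral>x. f x \<partial>unif01) = (LINT x:{0..<1}|lborel. f x)"
  unfolding unif01_density set_lebesgue_integral_def by (subst integral_density) auto

lemma emeasure_unif01_Ico:
  assumes "0 \<le> a" "a \<le> b" "b \<le> 1"
  shows "emeasure unif01 {a..<b} = ennreal (b - a)"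
proof -
  have "{0..<1} \<inter> {a..<b} = {a..<b}" using assms by auto
  then show ?thesis using assms by (simp add: unif01_def divide_ennreal_def)
qed

text \<open>The regression model: pairs \<open>(X, Y) = (fst z, snd z)\<close> with law \<open>P\<close>. The noise is
  \<open>snd z - s (fst z)\<close>.\<close>

locale regression =
  fixes P :: "(real \<times> real) measure" and s s' :: "real \<Rightarrow> real" and C \<sigma> :: real
  assumes smooth: "smooth01 s s' C" and law: "regression_law P s \<sigma>" and \<sigma>_pos: "\<sigma> > 0"
begin

sublocale prob_space P
  using law by (simp add: regression_law_def)

lemma sets_P [measurable_cong, simp]: "sets P = sets (borel \<Otimes>\<^sub>M borel)"
  using law by (simp add: regression_law_def)

lemma space_P [simp]: "space P = UNIV"
  using sets_eq_imp_space_eq[OF sets_P] by (simp add: space_pair_measure)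

lemma s_measurable [measurable]: "s \<in> borel_measurable borel"
  by (rule smooth01_measurable[OF smooth])

lemma s_bounded: "\<exists>M. \<forall>x. \<bar>s x\<bar> \<le> M"
proof (intro exI allI)
  fix x
  show "\<bar>s x\<bar> \<le> max (sup_norm01 s) \<bar>undefined\<bar>"
    using smooth01_le[OF smooth, of x] smooth
    by (cases "x \<in> {0..<1}") (auto simp: smooth01_def extensional_def)
qed

lemma distr_fst: "distr P borel fst = unif01"
  using law by (simp add: regression_law_def)

lemma integral_fst:
  fixes h :: "real \<Rightarrow> real"
  assumes [measurable]: "h \<in> borel_measurable borel"
  shows "(\<integral>z. h (fst z) \<partial>P) = (\<integral>x. h x \<partial>unif01)"
  unfolding distr_fst[symmetric] by (subst integral_distr) auto

lemma prob_fst_Ico: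
  assumes "0 \<le> a" "a \<le> b" "b \<le> 1"
  shows "prob (fst -` {a..<b}) = b - a"
proof -
  have "emeasure P (fst -` {a..<b}) = emeasure (distr P borel fst) {a..<b}"
    by (subst emeasure_distr) auto
  also have "\<dots> = ennreal (b - a)"
    unfolding distr_fst using assms by (rule emeasure_unif01_Ico)
  finally show ?thesis using assms by (simp add: measure_def)
qed

lemma integrable_bounded_fst:
  fixes h :: "real \<Rightarrow> real"
  assumes [measurable]: "h \<in> borel_measurable borel" and "\<And>x. \<bar>h x\<bar> \<le> M"
  shows "integrable P (\<lambda>z. h (fst z))"
  using assms(2) by (intro integrable_const_bound[where B = M]) auto

text \<open>The \<open>\<sigma>\<close>-algebra generated by the design variable.\<close>

abbreviation (input) "F \<equiv> vimage_algebra (space P) fst borel"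

lemma subalgebra_F: "subalgebra P F"
  by (auto simp: subalgebra_def sets_vimage_algebra2 intro!: measurable_sets[of fst P borel, simplified])

lemma sigma_finite_subalgebra_F: "sigma_finite_subalgebra P F"
proof -
  interpret finite_measure_subalgebra P F
    by unfold_locales (rule subalgebra_F)
  show ?thesis by unfold_locales
qed

lemma measurable_F:
  assumes "h \<in> borel_measurable borel"
  shows "(\<lambda>z. h (fst z)) \<in> borel_measurable F"
  using measurable_compose[OF measurable_vimage_algebra1[of fst "space P" borel] assms] by simp

lemma noise_centred:
  fixes h :: "real \<Rightarrow> real"
  assumes [measurable]: "h \<in> borel_measurable borel" and M: "\<And>x. \<bar>h x\<bar> \<le> M"
  shows "integrable P (\<lambda>z. h (fst z) * (snd z - s (fst z)))"
    and "(\<integral>z. h (fst z) * (snd z - s (fst z)) \<partial>P) = 0"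
proof -
  interpret sigma_finite_subalgebra P F by (rule sigma_finite_subalgebra_F)
  have int: "integrable P snd" and ce: "AE z in P. real_cond_exp P F snd z = s (fst z)"
    using law by (auto simp: regression_law_def)
  have i1: "integrable P (\<lambda>z. h (fst z) * snd z)"
  proof (rule Bochner_Integration.integrable_bound)
    show "integrable P (\<lambda>z. M * snd z)" using int by simp
    show "AE z in P. norm (h (fst z) * snd z) \<le> norm (M * snd z)"
      using M by (intro AE_I2) (auto simp: abs_mult intro!: mult_right_mono order_trans[OF M])
  qed measurable
  obtain K where K: "\<And>x. \<bar>s x\<bar> \<le> K" using s_bounded by blast
  have i2: "integrable P (\<lambda>z. h (fst z) * s (fst z))"
  proof (rule integrable_bounded_fst[where M = "M * K"])
    show "\<bar>h x * s x\<bar> \<le> M * K" for x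
      unfolding abs_mult using M[of x] K[of x] by (intro mult_mono) auto
  qed measurable
  show "integrable P (\<lambda>z. h (fst z) * (snd z - s (fst z)))"
    using i1 i2 by (simp add: right_diff_distrib)
  have "(\<integral>z. h (fst z) * snd z \<partial>P) = (\<integral>z. h (fst z) * real_cond_exp P F snd z \<partial>P)"
    by (rule real_cond_exp_intg(2)[symmetric]) (use i1 measurable_F[OF assms(1)] in auto)
  also have "\<dots> = (\<integral>z. h (fst z) * s (fst z) \<partial>P)"
    using ce by (intro integral_cong_AE) auto
  finally show "(\<integral>z. h (fst z) * (snd z - s (fst z)) \<partial>P) = 0"
    using i1 i2 by (simp add: right_diff_distrib)
qed

text \<open>Because \<open>\<sigma>\<^sup>2\<close> is positive, the prescribed value of the conditional variance forces the squared
  noise to be integrable, although \<open>real_cond_exp\<close> is total.\<close>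

lemma noise_square_nn:
  assumes [measurable]: "A \<in> sets borel"
  shows "(\<integral>\<^sup>+z. ennreal (indicator A (fst z) * (snd z - s (fst z))\<^sup>2) \<partial>P) = ennreal (\<sigma>\<^sup>2 * prob (fst -` A))"
proof -
  interpret sigma_finite_subalgebra P F by (rule sigma_finite_subalgebra_F)
  let ?q = "\<lambda>z. (snd z - s (fst z))\<^sup>2"
  have ce: "AE z in P. real_cond_exp P F ?q z = \<sigma>\<^sup>2"
    using law by (auto simp: regression_law_def case_prod_beta')
  have "AE z in P. 0 = nn_cond_exp P F (\<lambda>_. 0) z"
    by (rule nn_cond_exp_F_meas) auto
  then have q: "AE z in P. nn_cond_exp P F (\<lambda>z. ennreal (?q z)) z = ennreal (\<sigma>\<^sup>2)"
    using ce
  proof eventually_elim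
    case (elim z)
    have "(\<lambda>z. ennreal (- ?q z)) = (\<lambda>_. 0)" by (auto simp: ennreal_neg)
    then have "enn2real (nn_cond_exp P F (\<lambda>z. ennreal (?q z)) z) = \<sigma>\<^sup>2"
      using elim by (simp add: real_cond_exp_def)
    then show ?case using \<sigma>_pos
      by (cases "nn_cond_exp P F (\<lambda>z. ennreal (?q z)) z" rule: ennreal_cases) auto
  qed
  have "(\<integral>\<^sup>+z. ennreal (indicator A (fst z) * ?q z) \<partial>P) = (\<integral>\<^sup>+z. indicator A (fst z) * ennreal (?q z) \<partial>P)"
    by (intro nn_integral_cong) (auto simp: indicator_def)
  also have "\<dots> = (\<integral>\<^sup>+z. indicator A (fst z) * nn_cond_exp P F (\<lambda>z. ennreal (?q z)) z \<partial>P)"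
  proof (rule nn_cond_exp_intg[symmetric])
    show "(\<lambda>z. indicator A (fst z) :: ennreal) \<in> borel_measurable F"
      using measurable_compose[OF measurable_vimage_algebra1[of fst "space P" borel],
          of "indicator A" "borel :: ennreal measure"] by simp
  qed measurable
  also have "\<dots> = (\<integral>\<^sup>+z. ennreal (\<sigma>\<^sup>2) * indicator (fst -` A) z \<partial>P)"
    using q by (intro nn_integral_cong_AE) (auto simp: indicator_def)
  also have "\<dots> = ennreal (\<sigma>\<^sup>2) * emeasure P (fst -` A)"
    using measurable_sets[of fst P borel A] by (intro nn_integral_cmult_indicator) auto
  also have "\<dots> = ennreal (\<sigma>\<^sup>2 * prob (fst -` A))"
    by (simp add: emeasure_eq_measure ennreal_mult)
  finally show ?thesis .
qed

lemma
  assumes [measurable]: "A \<in> sets borel"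
  shows noise_square_integrable: "integrable P (\<lambda>z. indicator A (fst z) * (snd z - s (fst z))\<^sup>2)"
    and noise_square: "(\<integral>z. indicator A (fst z) * (snd z - s (fst z))\<^sup>2 \<partial>P) = \<sigma>\<^sup>2 * prob (fst -` A)"
proof -
  show "integrable P (\<lambda>z. indicator A (fst z) * (snd z - s (fst z))\<^sup>2)"
    by (rule integrableI_nn_integral_finite[OF _ _ noise_square_nn[OF assms]]) auto
  show "(\<integral>z. indicator A (fst z) * (snd z - s (fst z))\<^sup>2 \<partial>P) = \<sigma>\<^sup>2 * prob (fst -` A)"
    by (subst integral_eq_nn_integral) (auto simp: noise_square_nn)
qed

text \<open>Noise plus a bounded function \<open>h\<close> of the design variable that is centred on the cell \<open>A\<close>.\<close>

lemma
  fixes h :: "real \<Rightarrow> real"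
  assumes A [measurable]: "A \<in> sets borel" and h [measurable]: "h \<in> borel_measurable borel"
    and M: "\<And>x. x \<in> A \<Longrightarrow> \<bar>h x\<bar> \<le> M"
    and h0: "(\<integral>z. indicator A (fst z) * h (fst z) \<partial>P) = 0"
  shows noise_plus_centred: "(\<integral>z. indicator A (fst z) * (snd z - s (fst z) + h (fst z)) \<partial>P) = 0"
    and noise_plus_square_integrable: "integrable P (\<lambda>z. indicator A (fst z) * (snd z - s (fst z) + h (fst z))\<^sup>2)"
    and noise_plus_square: "(\<integral>z. indicator A (fst z) * (snd z - s (fst z) + h (fst z))\<^sup>2 \<partial>P) =
           \<sigma>\<^sup>2 * prob (fst -` A) + (\<integral>z. indicator A (fst z) * (h (fst z))\<^sup>2 \<partial>P)"
proof -
  let ?\<xi> = "\<lambda>z. snd z - s (fst z)"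
  have b1: "\<bar>indicator A x * h x\<bar> \<le> \<bar>M\<bar>" for x
    using M[of x] by (auto simp: indicator_def)
  have "\<bar>h x\<bar> ^ 2 \<le> \<bar>M\<bar> ^ 2" if "x \<in> A" for x
    using M[OF that] by (intro power_mono) auto
  then have b2: "\<bar>indicator A x * (h x)\<^sup>2\<bar> \<le> M\<^sup>2" for x
    by (auto simp: indicator_def)
  have i1: "integrable P (\<lambda>z. indicator A (fst z) * h (fst z))"
    using integrable_bounded_fst[of "\<lambda>x. indicator A x * h x", OF _ b1] by measurable
  have i2: "integrable P (\<lambda>z. indicator A (fst z) * (h (fst z))\<^sup>2)"
    using integrable_bounded_fst[of "\<lambda>x. indicator A x * (h x)\<^sup>2", OF _ b2] by measurable
  have n1: "integrable P (\<lambda>z. indicator A (fst z) * ?\<xi> z)" "(\<integral>z. indicator A (fst z) * ?\<xi> z \<partial>P) = 0"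
    using noise_centred[of "indicator A" 1] by (auto simp: indicator_def)
  have n2: "integrable P (\<lambda>z. (indicator A (fst z) * h (fst z)) * ?\<xi> z)"
    "(\<integral>z. (indicator A (fst z) * h (fst z)) * ?\<xi> z \<partial>P) = 0"
    using noise_centred[of "\<lambda>x. indicator A x * h x", OF _ b1] by auto
  note n3 = noise_square_integrable[OF A] noise_square[OF A]
  have "(\<integral>z. indicator A (fst z) * (?\<xi> z + h (fst z)) \<partial>P) =
      (\<integral>z. indicator A (fst z) * ?\<xi> z + indicator A (fst z) * h (fst z) \<partial>P)"
    by (simp add: distrib_left)
  also have "\<dots> = 0" using n1 i1 h0 by simp
  finally show "(\<integral>z. indicator A (fst z) * (?\<xi> z + h (fst z)) \<partial>P) = 0" .
  have eq: "indicator A (fst z) * (?\<xi> z + h (fst z))\<^sup>2 = indicator A (fst z) * (?\<xi> z)\<^sup>2 +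
      2 * ((indicator A (fst z) * h (fst z)) * ?\<xi> z) + indicator A (fst z) * (h (fst z))\<^sup>2" for z
    by (simp add: power2_eq_square algebra_simps)
  show "integrable P (\<lambda>z. indicator A (fst z) * (?\<xi> z + h (fst z))\<^sup>2)"
    unfolding eq by (intro Bochner_Integration.integrable_add integrable_mult_right n2 n3 i2)
  show "(\<integral>z. indicator A (fst z) * (?\<xi> z + h (fst z))\<^sup>2 \<partial>P) =
           \<sigma>\<^sup>2 * prob (fst -` A) + (\<integral>z. indicator A (fst z) * (h (fst z))\<^sup>2 \<partial>P)"
    unfolding eq using n2 n3 i2
    by (subst Bochner_Integration.integral_add Bochner_Integration.integrable_add integrable_mult_right; simp)+
qed

end

section \<open>The cells of the toy partition\<close>

text \<open>The left and the right endpoint of the cell with index \<open>j \<in> {0..k}\<close>; the two extreme cells are cut off at the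
  boundary of the unit interval.\<close>

definition toy_lo :: "nat \<Rightarrow> nat \<Rightarrow> real \<Rightarrow> real" where
  "toy_lo k j t = (if j = 0 then 0 else (real j - t) / real k)"

definition toy_hi :: "nat \<Rightarrow> nat \<Rightarrow> real \<Rightarrow> real" where
  "toy_hi k j t = (if j = k then 1 else (real j + 1 - t) / real k)"

lemma toy_partition_eq_image:
  assumes "k \<ge> 1"
  shows "toy_partition k t = (\<lambda>j. {toy_lo k j t ..< toy_hi k j t}) ` {0..k}"
proof -
  have "{0..k} = {0} \<union> {1..<k} \<union> {k}" using assms by auto
  then show ?thesis
    using assms by (auto simp: toy_partition_def toy_lo_def toy_hi_def image_Un)
qed

text \<open>For every real shift, two cells with different indices can only coincide if they are empty,
  and then they contribute nothing to the estimator.\<close>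

lemma tree_est_toy_sum:
  assumes "k \<ge> 1"
  shows "tree_est (toy_partition k t) n D x =
    (\<Sum>j=0..k. (\<Sum>i\<in>{1..n}. snd (D i) * indicator {toy_lo k j t ..< toy_hi k j t} (fst (D i)))
       / real (card {i\<in>{1..n}. fst (D i) \<in> {toy_lo k j t ..< toy_hi k j t}})
       * indicator {toy_lo k j t ..< toy_hi k j t} x)"
  unfolding tree_est_def toy_partition_eq_image[OF assms]
proof (subst sum.reindex_nontrivial, goal_cases)
  case (2 i j)
  have "\<not> (toy_lo k j t = toy_lo k i t \<and> toy_hi k j t = toy_hi k i t)"
    using 2 assms by (auto simp: toy_lo_def toy_hi_def divide_simps split: if_splits)
  then have "{toy_lo k i t ..< toy_hi k i t} = {}"
    using 2 Ico_eq_Ico[of "toy_lo k i t" "toy_hi k i t" "toy_lo k j t" "toy_hi k j t"] by auto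
  then show ?case by simp
qed auto

text \<open>Measurability is needed on all of the real line, not only for shifts in \<open>[0,1)\<close>, because the
  measure \<open>unif01\<close> is not complete.\<close>

lemma tree_est_toy_measurable:
  fixes M :: "(real \<times> real) measure" and N :: "real measure"
  assumes k: "k \<ge> 1" and M [measurable_cong]: "sets M = sets (borel \<Otimes>\<^sub>M borel)"
    and N [measurable_cong]: "sets N = sets borel"
  shows "(\<lambda>(D, t). tree_est (toy_partition k t) n D x)
           \<in> borel_measurable (Pi\<^sub>M {1..n} (\<lambda>_. M) \<Otimes>\<^sub>M N)"
proof -
  let ?L = "Pi\<^sub>M {1..n} (\<lambda>_. M) \<Otimes>\<^sub>M N"
  have comp [measurable]: "(\<lambda>p. fst p i) \<in> measurable ?L (borel \<Otimes>\<^sub>M borel)" if "i \<in> {1..n}" for i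
  proof -
    have "(\<lambda>p. fst p i) \<in> measurable ?L M"
      using that by (intro measurable_compose[OF measurable_fst measurable_component_singleton])
    then show ?thesis by (simp only: measurable_cong_sets[OF refl M])
  qed
  have lo [measurable]: "toy_lo k j \<in> borel_measurable borel" for j
    unfolding toy_lo_def by measurable
  have hi [measurable]: "toy_hi k j \<in> borel_measurable borel" for j
    unfolding toy_hi_def by measurable
  have ind [measurable]: "(\<lambda>p. indicator {toy_lo k j (snd p) ..< toy_hi k j (snd p)} (fst (fst p i)) :: real)
      \<in> borel_measurable ?L" if "i \<in> {1..n}" for i j
    unfolding indicator_def of_bool_def atLeastLessThan_iff using that by measurable
  have ind' [measurable]: "(\<lambda>p. indicator {toy_lo k j (snd p) ..< toy_hi k j (snd p)} x :: real)
      \<in> borel_measurable ?L" for j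
    unfolding indicator_def of_bool_def atLeastLessThan_iff by measurable
  have card: "real (card {i\<in>{1..n}. fst (D i) \<in> A}) = (\<Sum>i\<in>{1..n}. indicator A (fst (D i)))"
    for D :: "nat \<Rightarrow> real \<times> real" and A
    by (simp add: indicator_def sum.If_cases of_bool_def Int_def)
  show ?thesis
    unfolding case_prod_beta' tree_est_toy_sum[OF k] card
    by (intro borel_measurable_sum borel_measurable_times borel_measurable_divide ind ind')
      (auto intro: measurable_compose[OF comp measurable_snd])
qed

text \<open>The cell that contains \<open>x\<close>, and its midpoint, for \<open>x\<close> at distance at least \<open>1 / k\<close> from the
  boundary.\<close>

definition toy_cell :: "nat \<Rightarrow> real \<Rightarrow> real \<Rightarrow> real set" where
  "toy_cell k x t =
     {(of_int \<lfloor>real k * x + t\<rfloor> - t) / real k ..< (of_int \<lfloor>real k * x + t\<rfloor> + 1 - t) / real k}"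

definition toy_mid :: "nat \<Rightarrow> real \<Rightarrow> real \<Rightarrow> real" where
  "toy_mid k x t = (of_int \<lfloor>real k * x + t\<rfloor> + 1/2 - t) / real k"

lemma toy_mid_minus:
  assumes "k \<ge> 1"
  shows "toy_mid k x t - x = (1/2 - frac (real k * x + t)) / real k"
  using assms by (simp add: toy_mid_def frac_def field_simps)

lemma mem_toy_cell: "k \<ge> 1 \<Longrightarrow> x \<in> toy_cell k x t"
  by (simp add: toy_cell_def field_simps) linarith

lemma toy_cell_mid_dist:
  assumes "k \<ge> 1" "u \<in> toy_cell k x t"
  shows "\<bar>u - toy_mid k x t\<bar> \<le> 1 / real k"
proof -
  have "\<bar>real k * u - (of_int \<lfloor>real k * x + t\<rfloor> + 1/2 - t)\<bar> \<le> 1"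
    using assms by (simp add: toy_cell_def pos_divide_le_eq pos_less_divide_eq mult.commute abs_le_iff)
  moreover have "u - toy_mid k x t = (real k * u - (of_int \<lfloor>real k * x + t\<rfloor> + 1/2 - t)) / real k"
    using assms by (simp add: toy_mid_def field_simps)
  ultimately show ?thesis using assms by (simp add: abs_divide divide_right_mono)
qed

lemma toy_cell_dist:
  assumes "k \<ge> 1" "u \<in> toy_cell k x t"
  shows "\<bar>u - x\<bar> \<le> 1 / real k"
proof -
  have "\<bar>real k * u - real k * x\<bar> \<le> 1"
    using assms by (simp add: toy_cell_def pos_divide_le_eq pos_less_divide_eq mult.commute abs_le_iff) linarith
  moreover have "u - x = (real k * u - real k * x) / real k"
    using assms by (simp add: field_simps)
  ultimately show ?thesis using assms by (simp add: abs_divide divide_right_mono)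
qed

lemma toy_cell_bounds:
  assumes k: "k \<ge> 1" and x: "1 / real k \<le> x" "x \<le> 1 - 1 / real k" and t: "t \<in> {0..<1}"
  shows "1 \<le> \<lfloor>real k * x + t\<rfloor>" "\<lfloor>real k * x + t\<rfloor> < int k"
    "0 \<le> (of_int \<lfloor>real k * x + t\<rfloor> - t) / real k" "(of_int \<lfloor>real k * x + t\<rfloor> + 1 - t) / real k \<le> 1"
proof -
  have kx: "1 \<le> real k * x" "real k * x \<le> real k - 1"
    using k x by (simp_all add: field_simps)
  show 1: "1 \<le> \<lfloor>real k * x + t\<rfloor>" using kx t by (simp add: le_floor_iff)
  show 2: "\<lfloor>real k * x + t\<rfloor> < int k" using kx t by (simp add: floor_less_iff)
  have "1 \<le> real_of_int \<lfloor>real k * x + t\<rfloor>" "real_of_int \<lfloor>real k * x + t\<rfloor> + 1 \<le> real k"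
    using 1 2 by linarith+
  then have "0 \<le> of_int \<lfloor>real k * x + t\<rfloor> - t" "of_int \<lfloor>real k * x + t\<rfloor> + 1 - t \<le> real k"
    using t unfolding atLeastLessThan_iff by linarith+
  then show "0 \<le> (of_int \<lfloor>real k * x + t\<rfloor> - t) / real k" "(of_int \<lfloor>real k * x + t\<rfloor> + 1 - t) / real k \<le> 1"
    using k by (auto intro!: divide_nonneg_nonneg simp: pos_divide_le_eq)
qed

lemma toy_cell_subset:
  assumes "k \<ge> 1" "1 / real k \<le> x" "x \<le> 1 - 1 / real k" "t \<in> {0..<1}"
  shows "toy_cell k x t \<subseteq> {0..<1}"
  using toy_cell_bounds[OF assms] by (auto simp: toy_cell_def)

lemma tree_est_eq_cell_mean:
  assumes k: "k \<ge> 1" and x: "1 / real k \<le> x" "x \<le> 1 - 1 / real k" and t: "t \<in> {0..<1}"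
  shows "tree_est (toy_partition k t) n D x = cell_mean (fst -` toy_cell k x t) {1..n} snd D"
proof -
  define j where "j = nat \<lfloor>real k * x + t\<rfloor>"
  note b = toy_cell_bounds[OF assms]
  have j: "real j = of_int \<lfloor>real k * x + t\<rfloor>" "1 \<le> j" "j < k" unfolding j_def using b(1,2) by linarith+
  have cell: "{toy_lo k j t ..< toy_hi k j t} = toy_cell k x t"
    using j by (simp add: toy_cell_def toy_lo_def toy_hi_def)
  have kx: "1 \<le> real k * x" "real k * x \<le> real k - 1"
    using k x by (simp_all add: field_simps)
  have other: "x \<notin> {toy_lo k i t ..< toy_hi k i t}" if "i \<in> {0..k} - {j}" for i
  proof
    assume x: "x \<in> {toy_lo k i t ..< toy_hi k i t}"
    consider "i = 0" | "i = k" "i \<noteq> 0" | "i \<noteq> 0" "i \<noteq> k" by blast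
    then show False
    proof cases
      case 1
      then show False using x k t kx by (auto simp: toy_lo_def toy_hi_def field_simps)
    next
      case 2
      then show False using x k t kx by (auto simp: toy_lo_def toy_hi_def field_simps)
    next
      case 3
      then have "real i \<le> real k * x + t" "real k * x + t < real i + 1"
        using x k by (auto simp: toy_lo_def toy_hi_def field_simps)
      then have "\<lfloor>real k * x + t\<rfloor> = int i" by (intro floor_unique) auto
      then show False using that by (simp add: j_def)
    qed
  qed
  let ?f = "\<lambda>A. (\<Sum>i\<in>{1..n}. snd (D i) * indicator A (fst (D i))) / real (card {i\<in>{1..n}. fst (D i) \<in> A})"
  have "tree_est (toy_partition k t) n D x = (\<Sum>i\<in>{j}. ?f {toy_lo k i t ..< toy_hi k i t} * indicator {toy_lo k i t ..< toy_hi k i t} x)"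
    unfolding tree_est_toy_sum[OF k]
    using j other by (intro sum.mono_neutral_right) auto
  also have "\<dots> = ?f (toy_cell k x t)" using mem_toy_cell[OF k, of x t] by (simp add: cell)
  also have "\<dots> = cell_mean (fst -` toy_cell k x t) {1..n} snd D"
    by (simp add: cell_mean_def cell_count_def mult.commute indicator_def)
  finally show ?thesis .
qed

section \<open>Averages over the shift\<close>

lemma
  fixes f F :: "real \<Rightarrow> real"
  assumes ab: "a \<le> b" and F: "\<And>x. (F has_real_derivative f x) (at x)"
    and f: "continuous_on UNIV f"
  shows set_integrable_Ico: "set_integrable lborel {a..<b} f"
    and set_integral_Ico_FTC: "(LINT x:{a..<b}|lborel. f x) = F b - F a"
proof -
  have Icc: "set_integrable lborel {a..b} f"
    unfolding set_integrable_def by (intro borel_integrable_compact continuous_on_subset[OF f]) auto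
  then show "set_integrable lborel {a..<b} f"
    by (rule set_integrable_subset) auto
  have [measurable]: "f \<in> borel_measurable borel"
    using f by (rule borel_measurable_continuous_onI)
  have "(LINT x:{a..<b}|lborel. f x) = (LINT x|lborel. f x * indicator {a..b} x)"
    unfolding set_lebesgue_integral_def
    using AE_lborel_singleton[of b] by (intro integral_cong_AE) (auto simp: indicator_def)
  also have "\<dots> = F b - F a"
    using f by (intro integral_FTC_Icc_real ab F) (auto simp: continuous_on_eq_continuous_at)
  finally show "(LINT x:{a..<b}|lborel. f x) = F b - F a" .
qed

text \<open>The fractional part of a uniformly shifted point is uniform.\<close>

lemma integral_unif01_frac:
  fixes f F :: "real \<Rightarrow> real"
  assumes F: "\<And>x. (F has_real_derivative f x) (at x)" and f: "continuous_on UNIV f"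
  shows "(\<integral>t. f (frac (a + t)) \<partial>unif01) = F 1 - F 0"
proof -
  define b where "b = frac a"
  have b: "0 \<le> b" "b < 1" by (auto simp: b_def frac_lt_1)
  have [measurable]: "f \<in> borel_measurable borel"
    using f by (rule borel_measurable_continuous_onI)
  have frac1: "frac (a + t) = t + b" if "t \<in> {0..<1 - b}" for t
    using that b unfolding b_def frac_unique_iff by (auto simp: frac_def)
  have frac2: "frac (a + t) = t + (b - 1)" if "t \<in> {1 - b..<1}" for t
    using that b unfolding b_def frac_unique_iff by (auto simp: frac_def algebra_simps intro!: Ints_diff Ints_add)
  have D: "((\<lambda>t. F (t + c)) has_real_derivative f (t + c)) (at t)" for c t
    using DERIV_shift[of F "f (t + c)" t c] F by simp
  have C: "continuous_on UNIV (\<lambda>t. f (t + c))" for c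
    by (intro continuous_on_compose2[OF f]) (auto intro!: continuous_intros)
  note I1 = set_integrable_Ico[OF _ D C, of 0 "1 - b" b] set_integral_Ico_FTC[OF _ D C, of 0 "1 - b" b]
  note I2 = set_integrable_Ico[OF _ D C, of "1 - b" 1 "b - 1"] set_integral_Ico_FTC[OF _ D C, of "1 - b" 1 "b - 1"]
  have "(\<integral>t. f (frac (a + t)) \<partial>unif01) = (LINT t:{0..<1}|lborel. f (frac (a + t)))"
    unfolding frac_def by (intro integral_unif01) measurable
  also have "{0..<1} = {0..<1 - b} \<union> {1 - b..<1}" using b by auto
  also have "(LINT t:{0..<1 - b} \<union> {1 - b..<1}|lborel. f (frac (a + t))) =
      (LINT t:{0..<1 - b}|lborel. f (frac (a + t))) + (LINT t:{1 - b..<1}|lborel. f (frac (a + t)))"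
  proof (rule set_integral_Un)
    show "set_integrable lborel {0..<1 - b} (\<lambda>t. f (frac (a + t)))"
      using I1(1) b by (subst set_integrable_cong[OF refl refl, of _ _ "\<lambda>t. f (t + b)"]) (auto simp: frac1)
    show "set_integrable lborel {1 - b..<1} (\<lambda>t. f (frac (a + t)))"
      using I2(1) b by (subst set_integrable_cong[OF refl refl, of _ _ "\<lambda>t. f (t + (b - 1))"]) (auto simp: frac2)
  qed auto
  also have "(LINT t:{0..<1 - b}|lborel. f (frac (a + t))) = (LINT t:{0..<1 - b}|lborel. f (t + b))"
    by (intro set_lebesgue_integral_cong) (auto simp: frac1)
  also have "(LINT t:{1 - b..<1}|lborel. f (frac (a + t))) = (LINT t:{1 - b..<1}|lborel. f (t + (b - 1)))"
    by (intro set_lebesgue_integral_cong) (auto simp: frac2)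
  finally show ?thesis using I1(2) I2(2) b by simp
qed

lemma toy_mid_measurable [measurable]: "toy_mid k x \<in> borel_measurable borel"
  unfolding toy_mid_def by measurable

lemma integral_toy_mid:
  assumes "k \<ge> 1"
  shows "(\<integral>t. toy_mid k x t - x \<partial>unif01) = 0"
proof -
  let ?F = "\<lambda>v::real. (v / 2 - v\<^sup>2 / 2) / real k"
  have "(\<integral>t. (1/2 - frac (real k * x + t)) / real k \<partial>unif01) = ?F 1 - ?F 0"
    by (rule integral_unif01_frac[where f = "\<lambda>v. (1/2 - v) / real k"])
      (use assms in \<open>auto intro!: derivative_eq_intros continuous_intros simp: field_simps\<close>)
  then show ?thesis using assms by (simp add: toy_mid_minus)
qed

lemma integral_toy_mid_square:
  assumes "k \<ge> 1"
  shows "(\<integral>t. (toy_mid k x t - x)\<^sup>2 \<partial>unif01) = 1 / (12 * (real k)\<^sup>2)"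
proof -
  let ?F = "\<lambda>v::real. - ((1/2 - v) ^ 3 / 3) / (real k)\<^sup>2"
  have "(\<integral>t. ((1/2 - frac (real k * x + t)) / real k)\<^sup>2 \<partial>unif01) = ?F 1 - ?F 0"
    by (rule integral_unif01_frac[where f = "\<lambda>v. ((1/2 - v) / real k)\<^sup>2"])
      (use assms in \<open>auto intro!: derivative_eq_intros continuous_intros simp: field_simps power2_eq_square\<close>)
  then show ?thesis using assms by (simp add: toy_mid_minus power3_eq_cube)
qed

lemma integrable_toy_mid:
  assumes "k \<ge> 1"
  shows "integrable unif01 (\<lambda>t. toy_mid k x t - x)" "integrable unif01 (\<lambda>t. (toy_mid k x t - x)\<^sup>2)"
proof -
  interpret prob_space unif01 by (rule prob_space_unif01)
  have b: "\<bar>toy_mid k x t - x\<bar> \<le> 1 / real k" for t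
    using toy_cell_mid_dist[OF assms mem_toy_cell[OF assms], of x t] by (simp add: abs_minus_commute)
  show "integrable unif01 (\<lambda>t. toy_mid k x t - x)"
    using b by (intro integrable_const_bound[where B = "1 / real k"]) auto
  have "\<bar>toy_mid k x t - x\<bar>\<^sup>2 \<le> (1 / real k)\<^sup>2" for t
    using b by (intro power_mono) auto
  then show "integrable unif01 (\<lambda>t. (toy_mid k x t - x)\<^sup>2)"
    by (intro integrable_const_bound[where B = "(1 / real k)\<^sup>2"]) auto
qed

section \<open>Pointwise risk bounds\<close>

lemma ennreal_integral_le_nn_integral:
  fixes f :: "'a \<Rightarrow> real"
  assumes "integrable M f"
  shows "ennreal (\<integral>x. f x \<partial>M) \<le> (\<integral>\<^sup>+x. ennreal (f x) \<partial>M)"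
proof -
  have "(\<integral>x. f x \<partial>M) \<le> (\<integral>x. max 0 (f x) \<partial>M)"
    using assms by (intro integral_mono) auto
  then have "ennreal (\<integral>x. f x \<partial>M) \<le> ennreal (\<integral>x. max 0 (f x) \<partial>M)"
    by (rule ennreal_leI)
  also have "\<dots> = (\<integral>\<^sup>+x. ennreal (max 0 (f x)) \<partial>M)"
    using assms by (intro nn_integral_eq_integral[symmetric]) auto
  also have "\<dots> = (\<integral>\<^sup>+x. ennreal (f x) \<partial>M)"
    by (intro nn_integral_cong) (auto simp: max_def ennreal_neg)
  finally show ?thesis .
qed

lemma (in prob_space) square_integral_le_nn_integral:
  fixes f :: "'a \<Rightarrow> real"
  assumes [measurable]: "f \<in> borel_measurable M"
  shows "ennreal ((\<integral>x. f x \<partial>M)\<^sup>2) \<le> (\<integral>\<^sup>+x. ennreal ((f x)\<^sup>2) \<partial>M)"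
proof (cases "integrable M (\<lambda>x. (f x)\<^sup>2)")
  case True
  then have f: "integrable M f" by (rule square_integrable_imp_integrable[OF assms])
  have "(\<integral>x. f x \<partial>M)\<^sup>2 \<le> (\<integral>x. (f x)\<^sup>2 \<partial>M)"
    using variance_eq[OF f True] variance_positive[of f] by linarith
  then show ?thesis using True by (subst nn_integral_eq_integral) (auto intro: ennreal_leI)
next
  case False
  then have "(\<integral>\<^sup>+x. ennreal ((f x)\<^sup>2) \<partial>M) = \<infinity>"
    by (simp add: integrable_iff_bounded less_top[symmetric])
  then show ?thesis by simp
qed

context regression
begin

lemma prob_space_sample_law: "prob_space (sample_law P n)"
  unfolding sample_law_def by (intro prob_space_PiM prob_space_axioms)

context
  fixes k n :: nat and x t :: real
  assumes k: "k \<ge> 1" and n: "n \<ge> 1" and x: "1 / real k \<le> x" "x \<le> 1 - 1 / real k"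
    and t: "t \<in> {0..<1}"
begin

text \<open>The cell of \<open>x\<close>, the set of observations with design point in it, and its midpoint.\<close>

abbreviation (input) "A \<equiv> toy_cell k x t"
abbreviation (input) "B \<equiv> fst -` A"
abbreviation (input) "c \<equiv> toy_mid k x t"

lemma A_sets [measurable]: "A \<in> sets borel"
  by (simp add: toy_cell_def)

lemma B_sets [measurable]: "B \<in> sets P"
  using measurable_sets[of fst P borel A] by simp

lemma prob_B: "prob B = 1 / real k"
  unfolding toy_cell_def using k t toy_cell_bounds[OF k x t]
  by (subst prob_fst_Ico) (auto simp: divide_right_mono diff_divide_distrib[symmetric])

lemma x01: "x \<in> {0..<1}"
  using x k by (auto intro: order_trans[OF _ x(1)] le_less_trans[OF x(2)])

lemma A_subset: "A \<subseteq> {0..<1}"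
  by (rule toy_cell_subset[OF k x t])

lemma integral_centred_on_cell: "(\<integral>z. indicator A (fst z) * (fst z - c) \<partial>P) = 0"
proof -
  define a b where "a = (of_int \<lfloor>real k * x + t\<rfloor> - t) / real k"
    and "b = (of_int \<lfloor>real k * x + t\<rfloor> + 1 - t) / real k"
  have A: "A = {a..<b}" by (simp add: toy_cell_def a_def b_def)
  have "a \<le> b" using k by (simp add: a_def b_def divide_right_mono)
  have c: "c = (a + b) / 2"
    by (simp add: toy_mid_def a_def b_def add_divide_distrib[symmetric])
      (simp add: add_divide_distrib diff_divide_distrib)
  have "(\<integral>z. indicator A (fst z) * (fst z - c) \<partial>P) = (\<integral>u. indicator A u * (u - c) \<partial>unif01)"
    by (rule integral_fst) measurable
  also have "\<dots> = (LINT u:{0..<1}|lborel. indicator A u * (u - c))"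
    by (rule integral_unif01) measurable
  also have "\<dots> = (LINT u:{a..<b}|lborel. u - c)"
    unfolding set_lebesgue_integral_def using A_subset A
    by (intro Bochner_Integration.integral_cong) (auto simp: indicator_def)
  also have "\<dots> = (b - c)\<^sup>2 / 2 - (a - c)\<^sup>2 / 2"
    by (rule set_integral_Ico_FTC[OF \<open>a \<le> b\<close>, where F = "\<lambda>u. (u - c)\<^sup>2 / 2"])
      (auto intro!: derivative_eq_intros continuous_intros)
  also have "\<dots> = 0" by (simp add: c field_simps power2_eq_square)
  finally show ?thesis .
qed

context
  fixes h :: "real \<Rightarrow> real" and M :: real
  assumes h [measurable]: "h \<in> borel_measurable borel"
    and hM: "\<And>u. u \<in> A \<Longrightarrow> \<bar>h u\<bar> \<le> M"
    and h0: "(\<integral>z. indicator A (fst z) * h (fst z) \<partial>P) = 0"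
begin

text \<open>The centred term whose cell average is studied.\<close>

abbreviation (input) "g \<equiv> \<lambda>z. snd z - s (fst z) + h (fst z)"

lemma indicator_B: "indicator B z = (indicator A (fst z) :: real)"
  by (simp add: indicator_def)

lemma
  shows integrable_centred_cell_mean: "integrable (sample_law P n) (cell_mean B {1..n} g)"
    and integral_centred_cell_mean: "(\<integral>D. cell_mean B {1..n} g D \<partial>sample_law P n) = 0"
    and integrable_centred_cell_mean_square: "integrable (sample_law P n) (\<lambda>D. (cell_mean B {1..n} g D)\<^sup>2)"
    and centred_cell_mean_square_le:
      "(\<integral>D. (cell_mean B {1..n} g D)\<^sup>2 \<partial>sample_law P n) \<le> 2 * (\<sigma>\<^sup>2 + M\<^sup>2) * real k / real n"
    and centred_cell_mean_square_ge:
      "k \<le> n \<Longrightarrow> \<sigma>\<^sup>2 * real k / (4 * real n) \<le> (\<integral>D. (cell_mean B {1..n} g D)\<^sup>2 \<partial>sample_law P n)"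
proof -
  have gm: "g \<in> borel_measurable P" by measurable
  note np = noise_plus_square_integrable[OF A_sets h hM h0] noise_plus_centred[OF A_sets h hM h0]
    noise_plus_square[OF A_sets h hM h0]
  have prems: "integrable P (\<lambda>z. indicator B z * (g z)\<^sup>2)" "(\<integral>z. indicator B z * g z \<partial>P) = 0"
    using np(1,2) by (simp_all add: indicator_B)
  note cm = integrable_cell_mean[OF B_sets gm _ prems, of "{1..n}"]
    expectation_cell_mean[OF B_sets gm _ prems, of "{1..n}"]
    integrable_cell_mean_square[OF B_sets gm _ prems, of "{1..n}"]
    expectation_cell_mean_square[OF B_sets gm _ prems, of "{1..n}"]
  show "integrable (sample_law P n) (cell_mean B {1..n} g)"
    "(\<integral>D. cell_mean B {1..n} g D \<partial>sample_law P n) = 0"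
    "integrable (sample_law P n) (\<lambda>D. (cell_mean B {1..n} g D)\<^sup>2)"
    unfolding sample_law_def using cm by auto
  define V where "V = (\<integral>z. indicator A (fst z) * (g z)\<^sup>2 \<partial>P)"
  define R where "R = measure_pmf.expectation (binomial_pmf (n - 1) (1 / real k)) (\<lambda>j. 1 / (real j + 1)\<^sup>2)"
  have eq: "(\<integral>D. (cell_mean B {1..n} g D)\<^sup>2 \<partial>sample_law P n) = real n * V * R"
    unfolding sample_law_def using cm(4) by (simp add: prob_B V_def R_def indicator_B)
  have V: "V = \<sigma>\<^sup>2 / real k + (\<integral>z. indicator A (fst z) * (h (fst z))\<^sup>2 \<partial>P)"
    using np(3) by (simp add: V_def prob_B)
  have p: "1 / real k \<in> {0..1}" "1 / real k > 0" using k by auto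
  have h2: "\<bar>h u\<bar>\<^sup>2 \<le> M\<^sup>2" if "u \<in> A" for u
    using hM[OF that] by (intro power_mono) auto
  have "(\<integral>z. indicator A (fst z) * (h (fst z))\<^sup>2 \<partial>P) \<le> (\<integral>z. indicator B z * M\<^sup>2 \<partial>P)"
  proof (rule integral_mono)
    show "integrable P (\<lambda>z. indicator A (fst z) * (h (fst z))\<^sup>2)"
      using h2 by (intro integrable_const_bound[where B = "M\<^sup>2"]) (auto simp: indicator_def)
    show "integrable P (\<lambda>z. indicator B z * M\<^sup>2)"
      by (intro integrable_const_bound[where B = "M\<^sup>2"]) (auto simp: indicator_def)
  qed (use h2 in \<open>auto simp: indicator_def\<close>)
  also have "\<dots> = M\<^sup>2 / real k" by (simp add: prob_B)
  finally have V_le: "V \<le> (\<sigma>\<^sup>2 + M\<^sup>2) / real k" by (simp add: V add_divide_distrib)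
  have V_ge: "\<sigma>\<^sup>2 / real k \<le> V" unfolding V by (simp add: indicator_def)
  have V0: "V \<ge> 0" unfolding V_def by (simp add: indicator_def)
  have "R \<le> 2 / (real n * (real n + 1) * (1 / real k)\<^sup>2)"
    using binomial_inverse_square_le[OF p, of "n - 1"] n by (simp add: R_def of_nat_diff add.commute)
  also have "\<dots> \<le> 2 / (real n * real n * (1 / real k)\<^sup>2)"
    using n k by (intro divide_left_mono mult_right_mono mult_left_mono mult_pos_pos) auto
  also have "\<dots> = 2 * (real k)\<^sup>2 / (real n)\<^sup>2" by (simp add: power2_eq_square)
  finally have R_le: "R \<le> 2 * (real k)\<^sup>2 / (real n)\<^sup>2" .
  have "real n * V * R \<le> real n * ((\<sigma>\<^sup>2 + M\<^sup>2) / real k) * (2 * (real k)\<^sup>2 / (real n)\<^sup>2)"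
    using V_le R_le V0 by (intro mult_mono) (auto simp: R_def intro!: Bochner_Integration.integral_nonneg)
  also have "\<dots> = 2 * (\<sigma>\<^sup>2 + M\<^sup>2) * real k / real n"
    using n k by (simp add: power2_eq_square)
  finally show "(\<integral>D. (cell_mean B {1..n} g D)\<^sup>2 \<partial>sample_law P n) \<le> 2 * (\<sigma>\<^sup>2 + M\<^sup>2) * real k / real n"
    unfolding eq .
  show "\<sigma>\<^sup>2 * real k / (4 * real n) \<le> (\<integral>D. (cell_mean B {1..n} g D)\<^sup>2 \<partial>sample_law P n)" if kn: "k \<le> n"
  proof -
    have "real (n - 1) * (1 / real k) + 1 \<le> 2 * (real n / real k)"
    proof -
      have "real (n - 1) * (1 / real k) + 1 = (real (n - 1) + real k) / real k"
        using k by (simp add: field_simps)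
      also have "\<dots> \<le> (2 * real n) / real k"
        using kn by (intro divide_right_mono) auto
      finally show ?thesis by simp
    qed
    then have "(real (n - 1) * (1 / real k) + 1)\<^sup>2 \<le> (2 * (real n / real k))\<^sup>2"
      by (intro power_mono) auto
    moreover have "0 < (real (n - 1) * (1 / real k) + 1)\<^sup>2"
      by (intro zero_less_power add_nonneg_pos) auto
    ultimately have "1 / (2 * (real n / real k))\<^sup>2 \<le> 1 / (real (n - 1) * (1 / real k) + 1)\<^sup>2"
      using n k by (intro divide_left_mono mult_pos_pos) auto
    also have "\<dots> \<le> R"
      unfolding R_def by (rule binomial_inverse_square_ge[OF p(1)])
    finally have R_ge: "(real k)\<^sup>2 / (4 * (real n)\<^sup>2) \<le> R"
      by (simp add: power_mult_distrib power_divide)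
    have "\<sigma>\<^sup>2 * real k / (4 * real n) = real n * (\<sigma>\<^sup>2 / real k) * ((real k)\<^sup>2 / (4 * (real n)\<^sup>2))"
      using n k by (simp add: power2_eq_square)
    also have "\<dots> \<le> real n * V * R"
      using V_ge R_ge V0 by (intro mult_mono) auto
    finally show ?thesis unfolding eq .
  qed
qed

end

lemma prob_cell_empty:
  shows "integrable (sample_law P n) (\<lambda>D. if cell_count B {1..n} D = 0 then 1 else 0 :: real)"
    and "(\<integral>D. (if cell_count B {1..n} D = 0 then 1 else 0) \<partial>sample_law P n) = (1 - 1 / real k) ^ n"
    and "(1 - 1 / real k) ^ n \<le> exp (- (real n / real k))"
proof -
  show "integrable (sample_law P n) (\<lambda>D. if cell_count B {1..n} D = 0 then 1 else 0 :: real)"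
    unfolding sample_law_def
    using integrable_cell_count_fun[OF B_sets, of "{1..n}" "{1..n}" "\<lambda>j. if j = 0 then 1 else 0"] by simp
  show "(\<integral>D. (if cell_count B {1..n} D = 0 then 1 else 0) \<partial>sample_law P n) = (1 - 1 / real k) ^ n"
    unfolding sample_law_def using prob_cell_count_0[OF B_sets, of "{1..n}"] by (simp add: prob_B)
  have "(1 - 1 / real k) ^ n \<le> exp (- (1 / real k)) ^ n"
    using k exp_ge_add_one_self[of "- (1 / real k)"] by (intro power_mono) auto
  also have "\<dots> = exp (- (real n / real k))" by (simp add: exp_of_nat_mult[symmetric])
  finally show "(1 - 1 / real k) ^ n \<le> exp (- (real n / real k))" .
qed

text \<open>After the linear bias \<open>s' x * (c - x)\<close> is removed, the error is a centred cell average plus a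
  remainder of the order of the squared cell length, unless the cell is empty.\<close>

lemma tree_error_upper:
  "(\<integral>\<^sup>+D. ennreal ((tree_est (toy_partition k t) n D x - s x - s' x * (c - x))\<^sup>2) \<partial>sample_law P n)
     \<le> ennreal (4 * (\<sigma>\<^sup>2 + (sup_norm01 s' / real k)\<^sup>2) * real k / real n
          + 2 * C\<^sup>2 / real k ^ 4
          + 2 * (sup_norm01 s + sup_norm01 s')\<^sup>2 * exp (- (real n / real k)))"
proof -
  interpret S: prob_space "sample_law P n" by (rule prob_space_sample_law)
  define M where "M = sup_norm01 s' / real k"
  define K where "K = sup_norm01 s + sup_norm01 s'"
  define h where "h = (\<lambda>u. s' x * (u - c))"
  define r where "r = (\<lambda>u. s u - s x - s' x * (u - x))"
  have C0: "C \<ge> 0" by (rule smooth01_nonneg[OF smooth])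
  have cx: "\<bar>c - x\<bar> \<le> 1 / real k"
    using toy_cell_mid_dist[OF k mem_toy_cell[OF k], of x t] by (simp add: abs_minus_commute)
  have hm: "h \<in> borel_measurable borel" unfolding h_def by measurable
  have hM: "\<bar>h u\<bar> \<le> M" if "u \<in> A" for u
  proof -
    have "\<bar>s' x\<bar> * \<bar>u - c\<bar> \<le> sup_norm01 s' * (1 / real k)"
      using toy_cell_mid_dist[OF k that] smooth01_deriv_le[OF smooth x01] by (intro mult_mono) auto
    then show ?thesis by (simp add: h_def M_def abs_mult)
  qed
  have h0: "(\<integral>z. indicator A (fst z) * h (fst z) \<partial>P) = 0"
    using integral_centred_on_cell by (simp add: h_def mult.left_commute)
  let ?g = "\<lambda>z. snd z - s (fst z) + h (fst z)"
  define S where "S = cell_mean B {1..n} ?g"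
  define E where "E = (\<lambda>D :: nat \<Rightarrow> real \<times> real. if cell_count B {1..n} D = 0 then 1 else 0 :: real)"
  note cS = integrable_centred_cell_mean_square[OF hm hM h0] centred_cell_mean_square_le[OF hm hM h0]
  have r: "\<bar>r (fst z)\<bar> \<le> C / (real k)\<^sup>2" if "z \<in> B" for z
  proof -
    have "\<bar>fst z - x\<bar>\<^sup>2 \<le> (1 / real k)\<^sup>2"
      using toy_cell_dist[OF k, of "fst z" x t] that by (intro power_mono) auto
    then have "C * (fst z - x)\<^sup>2 \<le> C * (1 / real k)\<^sup>2" using C0 by (intro mult_left_mono) auto
    moreover have "\<bar>r (fst z)\<bar> \<le> C * (fst z - x)\<^sup>2"
      unfolding r_def using that A_subset x01 by (intro smooth01_taylor[OF smooth]) auto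
    ultimately show ?thesis by (simp add: power_divide)
  qed
  have pw: "(tree_est (toy_partition k t) n D x - s x - s' x * (c - x))\<^sup>2 \<le>
      2 * (S D)\<^sup>2 + 2 * (C / (real k)\<^sup>2)\<^sup>2 + 2 * K\<^sup>2 * E D" for D
  proof -
    have tree: "tree_est (toy_partition k t) n D x = cell_mean B {1..n} snd D"
      by (rule tree_est_eq_cell_mean[OF k x t])
    show ?thesis
    proof (cases "cell_count B {1..n} D = 0")
      case True
      have "\<bar>s' x\<bar> * \<bar>c - x\<bar> \<le> sup_norm01 s' * 1"
        using cx k smooth01_deriv_le[OF smooth x01] order_trans[OF cx, of 1] by (intro mult_mono) auto
      then have "\<bar>s x + s' x * (c - x)\<bar> \<le> K"
        using smooth01_le[OF smooth x01] abs_triangle_ineq[of "s x" "s' x * (c - x)"]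
        unfolding K_def abs_mult by linarith
      then have "\<bar>s x + s' x * (c - x)\<bar>\<^sup>2 \<le> K\<^sup>2" by (intro power_mono) auto
      moreover have "(tree_est (toy_partition k t) n D x - s x - s' x * (c - x))\<^sup>2 = (s x + s' x * (c - x))\<^sup>2"
        using True by (simp add: tree cell_mean_empty power2_eq_square algebra_simps)
      ultimately show ?thesis using True by (simp add: E_def)
          (smt (verit) zero_le_power2)
    next
      case False
      have "snd z = (?g z + r (fst z)) + (s x + s' x * (c - x))" for z :: "real \<times> real"
        by (simp add: h_def r_def algebra_simps)
      then have "cell_mean B {1..n} snd D = cell_mean B {1..n} (\<lambda>z. (?g z + r (fst z)) + (s x + s' x * (c - x))) D"
        by (intro arg_cong2[where f = "cell_mean B {1..n}"] ext) auto
      also have "\<dots> = S D + cell_mean B {1..n} (\<lambda>z. r (fst z)) D + (s x + s' x * (c - x))"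
        unfolding cell_mean_add S_def using False by (simp add: cell_mean_const)
      finally have eq: "tree_est (toy_partition k t) n D x - s x - s' x * (c - x) =
          S D + cell_mean B {1..n} (\<lambda>z. r (fst z)) D" by (simp add: tree)
      have "\<bar>cell_mean B {1..n} (\<lambda>z. r (fst z)) D\<bar>\<^sup>2 \<le> (C / (real k)\<^sup>2)\<^sup>2"
        using r C0 by (intro power_mono cell_mean_abs_le) auto
      moreover have "(S D + cell_mean B {1..n} (\<lambda>z. r (fst z)) D)\<^sup>2
          \<le> 2 * (S D)\<^sup>2 + 2 * (cell_mean B {1..n} (\<lambda>z. r (fst z)) D)\<^sup>2"
        using sum_squares_bound[of "S D" "cell_mean B {1..n} (\<lambda>z. r (fst z)) D"] by (simp add: power2_sum)
      ultimately show ?thesis unfolding eq using False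
        by (simp add: E_def)
    qed
  qed
  let ?q = "\<lambda>D. 2 * (S D)\<^sup>2 + 2 * (C / (real k)\<^sup>2)\<^sup>2 + 2 * K\<^sup>2 * E D"
  have int: "integrable (sample_law P n) ?q"
    using cS(1) prob_cell_empty(1) by (simp add: S_def E_def)
  have "(\<integral>\<^sup>+D. ennreal ((tree_est (toy_partition k t) n D x - s x - s' x * (c - x))\<^sup>2) \<partial>sample_law P n)
      \<le> (\<integral>\<^sup>+D. ennreal (?q D) \<partial>sample_law P n)"
    using pw by (intro nn_integral_mono ennreal_leI)
  also have "\<dots> = ennreal (\<integral>D. ?q D \<partial>sample_law P n)"
    using int by (intro nn_integral_eq_integral) (auto simp: E_def)
  finally have le: "(\<integral>\<^sup>+D. ennreal ((tree_est (toy_partition k t) n D x - s x - s' x * (c - x))\<^sup>2) \<partial>sample_law P n)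
      \<le> ennreal (\<integral>D. ?q D \<partial>sample_law P n)" .
  have "(\<integral>D. ?q D \<partial>sample_law P n) =
      2 * (\<integral>D. (S D)\<^sup>2 \<partial>sample_law P n) + 2 * (C / (real k)\<^sup>2)\<^sup>2 + 2 * K\<^sup>2 * (\<integral>D. E D \<partial>sample_law P n)"
    using cS(1) prob_cell_empty(1) by (simp add: S_def E_def S.prob_space)
  also have "(\<integral>D. E D \<partial>sample_law P n) = (1 - 1 / real k) ^ n"
    unfolding E_def by (rule prob_cell_empty(2))
  also have "2 * (\<integral>D. (S D)\<^sup>2 \<partial>sample_law P n) + 2 * (C / (real k)\<^sup>2)\<^sup>2 + 2 * K\<^sup>2 * (1 - 1 / real k) ^ n \<le>
      2 * (2 * (\<sigma>\<^sup>2 + M\<^sup>2) * real k / real n) + 2 * (C / (real k)\<^sup>2)\<^sup>2 + 2 * K\<^sup>2 * exp (- (real n / real k))"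
    using cS(2) prob_cell_empty(3) by (intro add_mono mult_left_mono order_refl) (auto simp: S_def)
  also have "\<dots> = 4 * (\<sigma>\<^sup>2 + (sup_norm01 s' / real k)\<^sup>2) * real k / real n + 2 * C\<^sup>2 / real k ^ 4
      + 2 * (sup_norm01 s + sup_norm01 s')\<^sup>2 * exp (- (real n / real k))"
    by (simp add: M_def K_def power_divide)
  finally show ?thesis using le by (meson ennreal_leI order_trans)
qed

text \<open>The cell mean of \<open>s\<close> is the value around which the tree estimator is centred; it differs from
  \<open>s x\<close> by the linear bias up to the squared cell length.\<close>

lemma tree_error_lower:
  assumes kn: "k \<le> n"
  shows "ennreal (\<sigma>\<^sup>2 * real k / (4 * real n) + (s' x)\<^sup>2 * (c - x)\<^sup>2 / 4 - C\<^sup>2 / (2 * real k ^ 4))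
     \<le> (\<integral>\<^sup>+D. ennreal ((tree_est (toy_partition k t) n D x - s x)\<^sup>2) \<partial>sample_law P n)"
proof -
  interpret S: prob_space "sample_law P n" by (rule prob_space_sample_law)
  have C0: "C \<ge> 0" by (rule smooth01_nonneg[OF smooth])
  obtain K where K: "\<And>u. \<bar>s u\<bar> \<le> K" using s_bounded by blast
  define sb where "sb = real k * (\<integral>z. indicator A (fst z) * s (fst z) \<partial>P)"
  define h where "h = (\<lambda>u. s u - sb)"
  define d where "d = sb - s x"
  have ind_int: "integrable P (\<lambda>z. indicator A (fst z) :: real)"
    by (intro integrable_const_bound[where B = 1]) auto
  have ind: "(\<integral>z. indicator A (fst z) \<partial>P) = 1 / real k"
  proof -
    have "(\<integral>z. indicator A (fst z) \<partial>P) = (\<integral>z. (indicator B z :: real) \<partial>P)"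
      by (intro Bochner_Integration.integral_cong) (auto simp: indicator_def)
    then show ?thesis by (simp add: prob_B)
  qed
  have As_int: "integrable P (\<lambda>z. indicator A (fst z) * s (fst z))"
    using K order_trans[OF abs_ge_zero K] by (intro integrable_const_bound[where B = K]) (auto simp: indicator_def)
  have hm: "h \<in> borel_measurable borel" unfolding h_def by measurable
  have hM: "\<bar>h u\<bar> \<le> K + \<bar>sb\<bar>" for u
    using K[of u] by (simp add: h_def)
  have h0: "(\<integral>z. indicator A (fst z) * h (fst z) \<partial>P) = 0"
    using ind As_int ind_int k by (simp add: h_def right_diff_distrib sb_def)
  let ?g = "\<lambda>z. snd z - s (fst z) + h (fst z)"
  define S where "S = cell_mean B {1..n} ?g"
  define E where "E = (\<lambda>D :: nat \<Rightarrow> real \<times> real. if cell_count B {1..n} D = 0 then 1 else 0 :: real)"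
  note cS = integrable_centred_cell_mean[OF hm hM h0] integral_centred_cell_mean[OF hm hM h0]
    integrable_centred_cell_mean_square[OF hm hM h0] centred_cell_mean_square_ge[OF hm hM h0 kn]
  let ?q = "\<lambda>D. (S D)\<^sup>2 + 2 * d * S D + d\<^sup>2 * (1 - E D)"
  have pw: "?q D \<le> (tree_est (toy_partition k t) n D x - s x)\<^sup>2" for D
  proof (cases "cell_count B {1..n} D = 0")
    case True
    then show ?thesis by (simp add: S_def E_def cell_mean_empty)
  next
    case False
    have "cell_mean B {1..n} snd D = cell_mean B {1..n} (\<lambda>z. ?g z + sb) D"
      by (simp add: h_def)
    also have "\<dots> = S D + sb"
      unfolding cell_mean_add S_def using False by (simp add: cell_mean_const)
    finally have "tree_est (toy_partition k t) n D x - s x = S D + d"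
      by (simp add: tree_est_eq_cell_mean[OF k x t] d_def)
    then show ?thesis using False by (simp add: E_def power2_sum)
  qed
  \<comment> \<open>Averaging the Taylor remainder of \<open>s\<close> at \<open>x\<close> over the cell gives \<open>d - s' x * (c - x)\<close>.\<close>
  have d2: "(s' x)\<^sup>2 * (c - x)\<^sup>2 / 2 - C\<^sup>2 / real k ^ 4 \<le> d\<^sup>2"
  proof -
    define r where "r = d - s' x * (c - x)"
    have lin_int: "integrable P (\<lambda>z. indicator A (fst z) * (fst z - c))"
      using toy_cell_mid_dist[OF k] by (intro integrable_const_bound[where B = "1 / real k"]) (auto simp: indicator_def)
    have "(\<integral>z. indicator A (fst z) * (s (fst z) - s x - s' x * (fst z - x)) \<partial>P) =
      (\<integral>z. indicator A (fst z) * s (fst z) - (s x + s' x * (c - x)) * indicator A (fst z)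
          - s' x * (indicator A (fst z) * (fst z - c)) \<partial>P)"
      by (intro Bochner_Integration.integral_cong) (auto simp: algebra_simps)
    also have "\<dots> = sb / real k - (s x + s' x * (c - x)) * (1 / real k) - s' x * 0"
      using As_int ind_int lin_int ind integral_centred_on_cell k by (simp add: sb_def)
    also have "\<dots> = r / real k" by (simp add: r_def d_def diff_divide_distrib add_divide_distrib)
    finally have "r = real k * (\<integral>z. indicator A (fst z) * (s (fst z) - s x - s' x * (fst z - x)) \<partial>P)"
      using k by simp
    also have "\<bar>\<dots>\<bar> \<le> real k * (\<integral>z. C / (real k)\<^sup>2 * indicator A (fst z) \<partial>P)"
    proof -
      let ?f = "\<lambda>z. indicator A (fst z) * (s (fst z) - s x - s' x * (fst z - x))"
      have le: "\<bar>?f z\<bar> \<le> C / (real k)\<^sup>2 * indicator A (fst z)" for z :: "real \<times> real"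
      proof (cases "fst z \<in> A")
        case True
        have "\<bar>fst z - x\<bar>\<^sup>2 \<le> (1 / real k)\<^sup>2"
          using toy_cell_dist[OF k True] by (intro power_mono) auto
        then have "C * (fst z - x)\<^sup>2 \<le> C * (1 / real k)\<^sup>2" using C0 by (intro mult_left_mono) auto
        moreover have "\<bar>s (fst z) - s x - s' x * (fst z - x)\<bar> \<le> C * (fst z - x)\<^sup>2"
          using True A_subset x01 by (intro smooth01_taylor[OF smooth]) auto
        ultimately show ?thesis using True by (simp add: power_divide)
      qed auto
      have "\<bar>\<integral>z. ?f z \<partial>P\<bar> \<le> (\<integral>z. C / (real k)\<^sup>2 * indicator A (fst z) \<partial>P)"
        using le ind_int by (intro integral_abs_bound_integral)
          (auto intro!: Bochner_Integration.integrable_bound[OF integrable_mult_right[OF ind_int, of "C / (real k)\<^sup>2"]] simp: C0)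
      then show ?thesis unfolding abs_mult abs_of_nat by (rule mult_left_mono) simp
    qed
    also have "\<dots> = C / (real k)\<^sup>2" using ind k by simp
    finally have "\<bar>r\<bar>\<^sup>2 \<le> (C / (real k)\<^sup>2)\<^sup>2" by (intro power_mono) auto
    then have "r\<^sup>2 \<le> C\<^sup>2 / real k ^ 4" by (simp add: power_divide)
    moreover have "(s' x * (c - x))\<^sup>2 / 2 - r\<^sup>2 \<le> d\<^sup>2"
    proof -
      have "a\<^sup>2 / 2 - b\<^sup>2 \<le> (a + b)\<^sup>2" for a b :: real
        using zero_le_power2[of "a + 2 * b"] by (simp add: power2_sum power_mult_distrib)
      from this[of "s' x * (c - x)" r] show ?thesis by (simp add: r_def)
    qed
    ultimately show ?thesis by (simp add: power_mult_distrib)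
  qed
  \<comment> \<open>Since \<open>k \<le> n\<close>, the cell is nonempty with probability at least \<open>1/2\<close>.\<close>
  have "(1 - 1 / real k) ^ n \<le> exp (- 1)"
    using prob_cell_empty(3) kn k by (auto intro: order_trans)
  also have "\<dots> \<le> (1 / 2 :: real)"
    using exp_ge_add_one_self[of 1] by (simp add: exp_minus divide_simps)
  finally have "d\<^sup>2 * (1 / 2) \<le> d\<^sup>2 * (1 - (1 - 1 / real k) ^ n)"
    by (intro mult_left_mono) auto
  moreover have "C\<^sup>2 / (2 * real k ^ 4) = C\<^sup>2 / real k ^ 4 / 2" by simp
  ultimately have "\<sigma>\<^sup>2 * real k / (4 * real n) + (s' x)\<^sup>2 * (c - x)\<^sup>2 / 4 - C\<^sup>2 / (2 * real k ^ 4) \<le>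
      (\<integral>D. (S D)\<^sup>2 \<partial>sample_law P n) + d\<^sup>2 * (1 - (1 - 1 / real k) ^ n)"
    using cS(4) d2 unfolding S_def by linarith
  also have "\<dots> = (\<integral>D. ?q D \<partial>sample_law P n)"
    using cS(1-3) prob_cell_empty(1,2) by (simp add: S_def E_def S.prob_space right_diff_distrib)
  finally have "ennreal (\<sigma>\<^sup>2 * real k / (4 * real n) + (s' x)\<^sup>2 * (c - x)\<^sup>2 / 4 - C\<^sup>2 / (2 * real k ^ 4))
      \<le> ennreal (\<integral>D. ?q D \<partial>sample_law P n)" by (rule ennreal_leI)
  also have "\<dots> \<le> (\<integral>\<^sup>+D. ennreal (?q D) \<partial>sample_law P n)"
    using cS(1-3) prob_cell_empty(1) by (intro ennreal_integral_le_nn_integral) (simp add: S_def E_def right_diff_distrib)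
  also have "\<dots> \<le> (\<integral>\<^sup>+D. ennreal ((tree_est (toy_partition k t) n D x - s x)\<^sup>2) \<partial>sample_law P n)"
    using pw by (intro nn_integral_mono ennreal_leI)
  finally show ?thesis .
qed

end

end

section \<open>Integrating over the shift and the evaluation point\<close>

lemma cell_mean_le_sum:
  assumes "finite I"
  shows "\<bar>cell_mean B I g D\<bar> \<le> (\<Sum>i\<in>I. \<bar>g (D i)\<bar>)"
proof (cases "cell_count B I D = 0")
  case True
  then show ?thesis using assms by (simp add: cell_mean_empty sum_nonneg)
next
  case False
  have "\<bar>\<Sum>i\<in>I. indicator B (D i) * g (D i)\<bar> \<le> (\<Sum>i\<in>I. \<bar>g (D i)\<bar>)"
    by (rule order_trans[OF sum_abs]) (auto intro!: sum_mono simp: indicator_def)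
  moreover have "\<bar>cell_mean B I g D\<bar> \<le> \<bar>\<Sum>i\<in>I. indicator B (D i) * g (D i)\<bar> / 1"
    unfolding cell_mean_def abs_divide using False by (intro divide_left_mono) auto
  ultimately show ?thesis by simp
qed

context regression
begin

lemma tree_est_measurable [measurable]:
  assumes "k \<ge> 1"
  shows "(\<lambda>(D, t). tree_est (toy_partition k t) n D x) \<in> borel_measurable (sample_law P n \<Otimes>\<^sub>M unif01)"
  unfolding sample_law_def using assms by (intro tree_est_toy_measurable) auto

lemma pair_sigma_finite_sample_unif: "pair_sigma_finite (sample_law P n) unif01"
proof -
  interpret S: prob_space "sample_law P n" by (rule prob_space_sample_law)
  interpret U: prob_space unif01 by (rule prob_space_unif01)
  show ?thesis by unfold_locales
qed

text \<open>The linear bias cancels on average over the shift.\<close>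

lemma forest_est_minus:
  assumes k: "k \<ge> 1" and x: "1 / real k \<le> x" "x \<le> 1 - 1 / real k" and D: "D \<in> space (sample_law P n)"
  shows "forest_est k n D x - s x =
    (\<integral>t. tree_est (toy_partition k t) n D x - s x - s' x * (toy_mid k x t - x) \<partial>unif01)"
proof -
  interpret U: prob_space unif01 by (rule prob_space_unif01)
  have [measurable]: "(\<lambda>t. tree_est (toy_partition k t) n D x) \<in> borel_measurable unif01"
    using measurable_compose[OF measurable_Pair1'[OF D] tree_est_measurable[OF k]] by simp
  have "integrable unif01 (\<lambda>t. tree_est (toy_partition k t) n D x)"
  proof (rule U.integrable_const_bound[where B = "\<Sum>i\<in>{1..n}. \<bar>snd (D i)\<bar>"])
    show "AE t in unif01. norm (tree_est (toy_partition k t) n D x) \<le> (\<Sum>i\<in>{1..n}. \<bar>snd (D i)\<bar>)"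
      using AE_unif01
    proof eventually_elim
      case (elim t)
      then show ?case
        using cell_mean_le_sum[of "{1..n}" "fst -` toy_cell k x t" snd D]
        by (simp add: tree_est_eq_cell_mean[OF k x elim])
    qed
  qed measurable
  then show ?thesis
    unfolding forest_est_def using integrable_toy_mid(1)[OF k, of x] integral_toy_mid[OF k, of x]
    by (simp add: U.prob_space[simplified])
qed

lemma forest_error_upper:
  assumes k: "k \<ge> 1" and n: "n \<ge> 1" and x: "1 / real k \<le> x" "x \<le> 1 - 1 / real k"
  shows "(\<integral>\<^sup>+D. ennreal ((forest_est k n D x - s x)\<^sup>2) \<partial>sample_law P n)
     \<le> ennreal (4 * (\<sigma>\<^sup>2 + (sup_norm01 s' / real k)\<^sup>2) * real k / real n
          + 2 * C\<^sup>2 / real k ^ 4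
          + 2 * (sup_norm01 s + sup_norm01 s')\<^sup>2 * exp (- (real n / real k)))" (is "_ \<le> ennreal ?U")
proof -
  interpret U: prob_space unif01 by (rule prob_space_unif01)
  interpret SU: pair_sigma_finite "sample_law P n" unif01 by (rule pair_sigma_finite_sample_unif)
  let ?q = "\<lambda>D t. tree_est (toy_partition k t) n D x - s x - s' x * (toy_mid k x t - x)"
  have q [measurable]: "(\<lambda>(D, t). ?q D t) \<in> borel_measurable (sample_law P n \<Otimes>\<^sub>M unif01)"
    using tree_est_measurable[OF k, of n x] by (simp add: case_prod_beta')
  have "(\<integral>\<^sup>+D. ennreal ((forest_est k n D x - s x)\<^sup>2) \<partial>sample_law P n)
      \<le> (\<integral>\<^sup>+D. \<integral>\<^sup>+t. ennreal ((?q D t)\<^sup>2) \<partial>unif01 \<partial>sample_law P n)"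
  proof (rule nn_integral_mono)
    fix D assume D: "D \<in> space (sample_law P n)"
    have "?q D \<in> borel_measurable unif01"
      using measurable_compose[OF measurable_Pair1'[OF D] q] by simp
    then show "ennreal ((forest_est k n D x - s x)\<^sup>2) \<le> (\<integral>\<^sup>+t. ennreal ((?q D t)\<^sup>2) \<partial>unif01)"
      unfolding forest_est_minus[OF k x D] by (rule U.square_integral_le_nn_integral)
  qed
  also have "\<dots> = (\<integral>\<^sup>+t. \<integral>\<^sup>+D. ennreal ((?q D t)\<^sup>2) \<partial>sample_law P n \<partial>unif01)"
    using SU.Fubini[of "\<lambda>(D, t). ennreal ((?q D t)\<^sup>2)"] q by (simp add: case_prod_beta')
  also have "\<dots> \<le> (\<integral>\<^sup>+t. ennreal ?U \<partial>unif01)"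
    using AE_unif01 tree_error_upper[OF k n x] by (intro nn_integral_mono_AE) auto
  also have "\<dots> = ennreal ?U" by (simp add: U.emeasure_space_1[simplified])
  finally show ?thesis .
qed

lemma tree_error_lower_average:
  assumes k: "k \<ge> 1" and n: "n \<ge> 1" and kn: "k \<le> n" and x: "1 / real k \<le> x" "x \<le> 1 - 1 / real k"
  shows "ennreal (\<sigma>\<^sup>2 * real k / (4 * real n) + (s' x)\<^sup>2 / (48 * (real k)\<^sup>2) - C\<^sup>2 / (2 * real k ^ 4))
     \<le> (\<integral>\<^sup>+(D, t). ennreal ((tree_est (toy_partition k t) n D x - s x)\<^sup>2) \<partial>(sample_law P n \<Otimes>\<^sub>M unif01))"
proof -
  interpret U: prob_space unif01 by (rule prob_space_unif01)
  interpret SU: pair_sigma_finite "sample_law P n" unif01 by (rule pair_sigma_finite_sample_unif)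
  let ?f = "\<lambda>t. \<sigma>\<^sup>2 * real k / (4 * real n) + (s' x)\<^sup>2 * (toy_mid k x t - x)\<^sup>2 / 4 - C\<^sup>2 / (2 * real k ^ 4)"
  have int: "integrable unif01 ?f" using integrable_toy_mid(2)[OF k, of x] by simp
  have "(\<integral>t. ?f t \<partial>unif01) = \<sigma>\<^sup>2 * real k / (4 * real n) + (s' x)\<^sup>2 * (1 / (12 * (real k)\<^sup>2)) / 4 - C\<^sup>2 / (2 * real k ^ 4)"
    using integrable_toy_mid(2)[OF k, of x] integral_toy_mid_square[OF k, of x] by (simp add: U.prob_space[simplified])
  then have "ennreal (\<sigma>\<^sup>2 * real k / (4 * real n) + (s' x)\<^sup>2 / (48 * (real k)\<^sup>2) - C\<^sup>2 / (2 * real k ^ 4))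
      = ennreal (\<integral>t. ?f t \<partial>unif01)" by simp
  also have "\<dots> \<le> (\<integral>\<^sup>+t. ennreal (?f t) \<partial>unif01)" by (rule ennreal_integral_le_nn_integral[OF int])
  also have "\<dots> \<le> (\<integral>\<^sup>+t. \<integral>\<^sup>+D. ennreal ((tree_est (toy_partition k t) n D x - s x)\<^sup>2) \<partial>sample_law P n \<partial>unif01)"
    using AE_unif01 tree_error_lower[OF k n x _ kn] by (intro nn_integral_mono_AE) auto
  also have "\<dots> = (\<integral>\<^sup>+(D, t). ennreal ((tree_est (toy_partition k t) n D x - s x)\<^sup>2) \<partial>(sample_law P n \<Otimes>\<^sub>M unif01))"
    using SU.nn_integral_snd[of "\<lambda>(D, t). ennreal ((tree_est (toy_partition k t) n D x - s x)\<^sup>2)"]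
      tree_est_measurable[OF k, of n x] by (simp add: case_prod_beta')
  finally show ?thesis .
qed

lemma inverse_le_imp_interior:
  assumes "0 < \<epsilon>" "1 / \<epsilon> \<le> real k" "x \<in> {\<epsilon>..1-\<epsilon>}"
  shows "k \<ge> 1" "1 / real k \<le> x" "x \<le> 1 - 1 / real k"
proof -
  have "0 < 1 / \<epsilon>" using assms by simp
  then have "real k > 0" using assms(2) by linarith
  then show "k \<ge> 1" by simp
  have "1 / real k \<le> \<epsilon>" using assms(1,2) \<open>real k > 0\<close> by (simp add: field_simps)
  then show "1 / real k \<le> x" "x \<le> 1 - 1 / real k" using assms(3) by auto
qed

lemma forest_risk_upper:
  assumes \<epsilon>: "0 < \<epsilon>" "\<epsilon> < 1/2" and k: "1 / \<epsilon> \<le> real k" and n: "n \<ge> 1"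
  shows "forest_risk P s \<epsilon> n k
     \<le> ennreal (4 * (\<sigma>\<^sup>2 + (sup_norm01 s' / real k)\<^sup>2) * real k / real n
          + 2 * C\<^sup>2 / real k ^ 4
          + 2 * (sup_norm01 s + sup_norm01 s')\<^sup>2 * exp (- (real n / real k)))" (is "_ \<le> ennreal ?U")
proof -
  have "forest_risk P s \<epsilon> n k \<le> (\<integral>\<^sup>+x\<in>{\<epsilon>..1-\<epsilon>}. ennreal ?U \<partial>lborel)"
    unfolding forest_risk_def using forest_error_upper[OF _ n] inverse_le_imp_interior[OF \<epsilon>(1) k]
    by (intro nn_integral_mono) (auto simp: indicator_def)
  also have "\<dots> = ennreal ?U * ennreal (1 - 2 * \<epsilon>)"
    using \<epsilon> by (subst nn_integral_cmult_indicator) (auto simp: emeasure_lborel_Icc)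
  also have "\<dots> \<le> ennreal ?U * 1"
    using \<epsilon> by (intro mult_left_mono) (auto simp: ennreal_le_1)
  finally show ?thesis by simp
qed

lemma tree_risk_lower:
  assumes \<epsilon>: "0 < \<epsilon>" "\<epsilon> < 1/2" and k: "1 / \<epsilon> \<le> real k" and kn: "k \<le> n"
  shows "ennreal ((1 - 2 * \<epsilon>) * \<sigma>\<^sup>2 * real k / (4 * real n)
      + (LINT x:{\<epsilon>..1-\<epsilon>}|lborel. (s' x)\<^sup>2) / (48 * (real k)\<^sup>2) - C\<^sup>2 / (2 * real k ^ 4)) \<le> tree_risk P s \<epsilon> n k"
proof -
  let ?I = "{\<epsilon>..1-\<epsilon>}"
  let ?G = "\<lambda>x. \<sigma>\<^sup>2 * real k / (4 * real n) + (s' x)\<^sup>2 / (48 * (real k)\<^sup>2) - C\<^sup>2 / (2 * real k ^ 4)"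
  define a where "a = \<sigma>\<^sup>2 * real k / (4 * real n)"
  define b where "b = C\<^sup>2 / (2 * real k ^ 4)"
  have k1: "k \<ge> 1" and n: "n \<ge> 1"
    using inverse_le_imp_interior(1)[OF \<epsilon>(1) k, of \<epsilon>] \<epsilon> kn by auto
  have "continuous_on ?I s'"
    using \<epsilon> by (intro continuous_on_subset[OF smooth01_deriv_continuous[OF smooth]]) auto
  then have int: "set_integrable lborel ?I (\<lambda>x. (s' x)\<^sup>2)"
    unfolding set_integrable_def by (intro borel_integrable_compact continuous_intros) auto
  have intc: "integrable lborel (\<lambda>x. indicator ?I x * r)" for r :: real
    using borel_integrable_compact[of ?I "\<lambda>_. r"] by simp
  have lc: "(LINT x|lborel. indicator ?I x * r) = (1 - 2 * \<epsilon>) * r" for r :: real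
    using \<epsilon> by simp
  have eq: "indicator ?I x * ?G x = indicator ?I x * a + (indicator ?I x *\<^sub>R (s' x)\<^sup>2) / (48 * (real k)\<^sup>2) - indicator ?I x * b" for x
    by (auto simp: indicator_def a_def b_def)
  have intG: "integrable lborel (\<lambda>x. indicator ?I x * ?G x)"
    unfolding eq using int intc unfolding set_integrable_def
    by (intro Bochner_Integration.integrable_add Bochner_Integration.integrable_diff integrable_divide) auto
  have "(LINT x|lborel. indicator ?I x * ?G x) =
      (1 - 2 * \<epsilon>) * a + (LINT x:?I|lborel. (s' x)\<^sup>2) / (48 * (real k)\<^sup>2) - (1 - 2 * \<epsilon>) * b"
    unfolding eq lc[symmetric] set_lebesgue_integral_def using int intc unfolding set_integrable_def
    by (subst Bochner_Integration.integral_diff Bochner_Integration.integral_add;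
        (intro Bochner_Integration.integrable_add integrable_divide)?; simp)+
  moreover have "(1 - 2 * \<epsilon>) * b \<le> 1 * b"
    using \<epsilon> by (intro mult_right_mono) (auto simp: b_def)
  ultimately have "(1 - 2 * \<epsilon>) * \<sigma>\<^sup>2 * real k / (4 * real n)
      + (LINT x:?I|lborel. (s' x)\<^sup>2) / (48 * (real k)\<^sup>2) - C\<^sup>2 / (2 * real k ^ 4) \<le> (LINT x|lborel. indicator ?I x * ?G x)"
    by (simp add: a_def b_def mult.assoc)
  then have "ennreal ((1 - 2 * \<epsilon>) * \<sigma>\<^sup>2 * real k / (4 * real n)
      + (LINT x:?I|lborel. (s' x)\<^sup>2) / (48 * (real k)\<^sup>2) - C\<^sup>2 / (2 * real k ^ 4)) \<le> ennreal (LINT x|lborel. indicator ?I x * ?G x)"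
    by (rule ennreal_leI)
  also have "\<dots> \<le> (\<integral>\<^sup>+x. ennreal (indicator ?I x * ?G x) \<partial>lborel)"
    by (rule ennreal_integral_le_nn_integral[OF intG])
  also have "\<dots> \<le> tree_risk P s \<epsilon> n k"
    unfolding tree_risk_def
  proof (rule nn_integral_mono)
    fix x
    show "ennreal (indicator ?I x * ?G x) \<le>
       (\<integral>\<^sup>+(D, t). ennreal ((tree_est (toy_partition k t) n D x - s x)\<^sup>2) \<partial>(sample_law P n \<Otimes>\<^sub>M unif01)) * indicator ?I x"
    proof (cases "x \<in> ?I")
      case True
      then show ?thesis
        using tree_error_lower_average[OF k1 n kn inverse_le_imp_interior(2,3)[OF \<epsilon>(1) k True]] by simp
    qed simp
  qed
  finally show ?thesis .
qed

end

section \<open>Choosing the number of cells\<close>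

lemma powr_fifth_eventually:
  fixes v K M :: real
  assumes "v > 0" "K > 0" "M > 0"
  shows "\<forall>\<^sub>F n :: nat in sequentially. M \<le> (real n / v) powr (1/5)"
    and "\<forall>\<^sub>F n :: nat in sequentially. (real n / v) powr (1/5) + 1 \<le> real n"
    and "\<forall>\<^sub>F n :: nat in sequentially. K / ((real n / v) powr (1/5) * real n) \<le> (v / real n) powr (4/5)"
    and "\<forall>\<^sub>F n :: nat in sequentially.
           K * exp (- (real n / (2 * (real n / v) powr (1/5)))) \<le> (v / real n) powr (4/5)"
  using assms by real_asymp+


text \<open>Here \<open>v\<close> stands for \<open>\<sigma>\<^sup>2\<close>, and \<open>a\<close> and \<open>b\<close> for the sup-norms of \<open>s\<close> and \<open>s'\<close>. The number
  \<open>\<lceil>(n / \<sigma>\<^sup>2) powr (1/5)\<rceil>\<close> of cells balances the variance \<open>\<sigma>\<^sup>2 k / n\<close> and the squared bias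
  \<open>C\<^sup>2 / k ^ 4\<close>; the other contributions to the risk of the forest are of smaller order.\<close>

lemma forest_choice:
  fixes v \<epsilon> a b :: real
  assumes v: "v > 0" and \<epsilon>: "\<epsilon> > 0"
  shows "\<exists>N. \<forall>n\<ge>N. n \<ge> 1 \<and> (\<exists>k. 1 / \<epsilon> \<le> real k \<and> k \<le> n \<and>
     (\<forall>C. 4 * (v + (b / real k)\<^sup>2) * real k / real n + 2 * C\<^sup>2 / real k ^ 4
          + 2 * (a + b)\<^sup>2 * exp (- (real n / real k)) \<le> (10 + 2 * C\<^sup>2) * (v / real n) powr (4/5)))"
proof -
  \<comment> \<open>The summand \<open>1\<close> keeps both constants positive even if the squares vanish.\<close>
  define K1 where "K1 = 4 * b\<^sup>2 + 1"
  define K2 where "K2 = 2 * (a + b)\<^sup>2 + 1"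
  have K: "K1 > 0" "K2 > 0" by (auto simp: K1_def K2_def add_nonneg_pos)
  have M: "1 / \<epsilon> + 1 > 0" using \<epsilon> by (simp add: add_pos_pos)
  have "\<forall>\<^sub>F n :: nat in sequentially. n \<ge> 1 \<and> (\<exists>k. 1 / \<epsilon> \<le> real k \<and> k \<le> n \<and>
     (\<forall>C. 4 * (v + (b / real k)\<^sup>2) * real k / real n + 2 * C\<^sup>2 / real k ^ 4
          + 2 * (a + b)\<^sup>2 * exp (- (real n / real k)) \<le> (10 + 2 * C\<^sup>2) * (v / real n) powr (4/5)))"
    using powr_fifth_eventually(1)[OF v K(1) M] powr_fifth_eventually(2)[OF v K(1) M]
      powr_fifth_eventually(3)[OF v K(1) M] powr_fifth_eventually(4)[OF v K(2) M]
  proof eventually_elim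
    case (elim n)
    define r where "r = (real n / v) powr (1/5)"
    define k where "k = nat \<lceil>r\<rceil>"
    define R where "R = (v / real n) powr (4/5)"
    have M1: "1 / \<epsilon> > 0" using \<epsilon> by simp
    have r: "1 \<le> r" "1 / \<epsilon> \<le> r" "r + 1 \<le> real n" using elim(1,2) M1 unfolding r_def by linarith+
    have n: "real n > 0" using r by linarith
    have kr: "r \<le> real k" "real k \<le> 2 * r" "real k \<le> r + 1" using r unfolding k_def by linarith+
    have kpos: "real k > 0" using kr r by linarith
    have kn: "k \<le> n" using kr r by linarith
    have rpos: "r > 0" using r by linarith
    have r4: "r ^ 4 = (real n / v) powr (4/5)"
      using n v by (simp add: r_def powr_powr flip: powr_realpow)
    have R: "R = 1 / r ^ 4"
      unfolding r4 R_def using n v by (simp add: powr_divide)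
    have r5: "r ^ 5 = real n / v"
      using n v by (simp add: r_def powr_powr flip: powr_realpow)
    have t1: "4 * v * real k / real n \<le> 8 * R"
    proof -
      have "4 * v * real k / real n \<le> 4 * v * (2 * r) / real n"
        using kr v n by (intro divide_right_mono mult_left_mono) auto
      also have "\<dots> = 8 * r / r ^ 5" using v n by (simp add: r5)
      also have "\<dots> = 8 * R" using rpos by (simp add: R eval_nat_numeral)
      finally show ?thesis .
    qed
    have t2: "4 * (b / real k)\<^sup>2 * real k / real n \<le> R"
    proof -
      have "4 * (b / real k)\<^sup>2 * real k / real n = 4 * b\<^sup>2 / (real k * real n)"
        using kpos by (simp add: power2_eq_square)
      also have "\<dots> \<le> K1 / (real k * real n)"
        using kpos n by (intro divide_right_mono) (auto simp: K1_def)
      also have "\<dots> \<le> K1 / (r * real n)"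
        using kr rpos n K by (intro divide_left_mono mult_right_mono mult_pos_pos) auto
      also have "\<dots> \<le> R" using elim(3) by (simp add: r_def R_def)
      finally show ?thesis .
    qed
    have t3: "2 * (a + b)\<^sup>2 * exp (- (real n / real k)) \<le> R"
    proof -
      have "real n / (2 * r) \<le> real n / real k"
        using kr kpos n by (intro divide_left_mono mult_pos_pos) auto
      then have "2 * (a + b)\<^sup>2 * exp (- (real n / real k)) \<le> K2 * exp (- (real n / (2 * r)))"
        by (intro mult_mono) (auto simp: K2_def)
      also have "\<dots> \<le> R" using elim(4) by (simp add: r_def R_def)
      finally show ?thesis .
    qed
    have t4: "2 * C\<^sup>2 / real k ^ 4 \<le> 2 * C\<^sup>2 * R" for C
    proof -
      have "2 * C\<^sup>2 / real k ^ 4 \<le> 2 * C\<^sup>2 / r ^ 4"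
        using kr rpos kpos by (intro divide_left_mono power_mono mult_pos_pos) auto
      then show ?thesis by (simp add: R)
    qed
    have "4 * (v + (b / real k)\<^sup>2) * real k / real n + 2 * C\<^sup>2 / real k ^ 4
          + 2 * (a + b)\<^sup>2 * exp (- (real n / real k)) \<le> (10 + 2 * C\<^sup>2) * R" for C
    proof -
      have "4 * (v + (b / real k)\<^sup>2) * real k / real n = 4 * v * real k / real n + 4 * (b / real k)\<^sup>2 * real k / real n"
        by (simp add: distrib_left distrib_right add_divide_distrib)
      then show ?thesis using t1 t2 t3 t4[of C] by (simp add: distrib_right)
    qed
    then show ?case using r kr kn n unfolding R_def by (intro conjI exI[of _ k]) auto
  qed
  then show ?thesis by (simp add: eventually_sequentially)
qed

lemma variance_bias_tradeoff:
  fixes a b k :: real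
  assumes "a > 0" "b > 0" "k > 0"
  shows "a powr (1/3) * b powr (2/3) \<le> b * k + a / k\<^sup>2"
proof -
  define r where "r = (a / b) powr (1/3)"
  have r: "r > 0" using assms by (simp add: r_def)
  have e: "b powr (1/3) * b powr (2/3) = b"
    using assms by (simp flip: powr_add)
  have br: "b * r = a powr (1/3) * b powr (2/3)"
  proof -
    have "b * r = (b powr (1/3) * b powr (2/3)) * (a powr (1/3) / b powr (1/3))"
      using assms by (simp add: e r_def powr_divide)
    then show ?thesis using assms by simp
  qed
  have "r ^ 3 = a / b" using assms by (simp add: r_def powr_powr flip: powr_realpow)
  then have "r\<^sup>2 * r * b = a" using assms by (simp add: power2_eq_square power3_eq_cube eq_divide_eq)
  then have ar: "a / r\<^sup>2 = b * r" using r by (auto simp: mult.commute)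
  show ?thesis
  proof (cases "r \<le> k")
    case True
    then have "b * r \<le> b * k" using assms by (intro mult_left_mono) auto
    then show ?thesis using br assms by (simp add: add_increasing2)
  next
    case False
    then have "a / r\<^sup>2 \<le> a / k\<^sup>2"
      using assms r by (intro divide_left_mono power_mono) auto
    then show ?thesis using br ar assms by (simp add: add_increasing)
  qed
qed

lemma smooth01_deriv_eq:
  assumes "smooth01 s s' C" "x \<in> {0<..<1}"
  shows "s' x = deriv s x"
proof -
  have "(s has_real_derivative s' x) (at x within {0..<1})"
    using assms by (auto simp: smooth01_def)
  then have "(s has_real_derivative s' x) (at x within {0<..<1})"
    by (rule DERIV_subset) auto
  then have "(s has_real_derivative s' x) (at x)"
    using assms(2) by (simp add: at_within_open[of x "{0<..<1}"])
  then show ?thesis by (rule DERIV_imp_deriv[symmetric])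
qed

text \<open>As \<open>s\<close> determines its derivative on \<open>(0,1)\<close>, the energy \<open>\<integral> (s')\<^sup>2\<close> may enter a constant that
  depends on \<open>s\<close> and \<open>\<epsilon>\<close> only.\<close>

definition tree_constant :: "(real \<Rightarrow> real) \<Rightarrow> real \<Rightarrow> real" where
  "tree_constant s \<epsilon> =
     ((LINT x:{\<epsilon>..1-\<epsilon>}|lborel. (deriv s x)\<^sup>2) / 96) powr (1/3) * ((1 - 2 * \<epsilon>) / 4) powr (2/3)"

lemma tree_lower_bound:
  fixes s s' :: "real \<Rightarrow> real"
  assumes smooth: "smooth01 s s' C" and \<epsilon>: "0 < \<epsilon>" "\<epsilon> < 1/2" and \<sigma>: "\<sigma> > 0"
    and law: "regression_law P s \<sigma>" and I: "I = (LINT x:{\<epsilon>..1-\<epsilon>}|lborel. (s' x)\<^sup>2)" "I > 0"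
    and k: "1 / \<epsilon> + 48 * C\<^sup>2 / I \<le> real k" "k \<le> n"
  shows "tree_constant s \<epsilon> > 0"
    and "ennreal (tree_constant s \<epsilon> * (\<sigma>\<^sup>2 / real n) powr (2/3)) \<le> tree_risk P s \<epsilon> n k"
proof -
  interpret regression P s s' C \<sigma> by unfold_locales (fact smooth law \<sigma>)+
  have "(LINT x:{\<epsilon>..1-\<epsilon>}|lborel. (deriv s x)\<^sup>2) = I"
    unfolding I using \<epsilon> by (intro set_lebesgue_integral_cong) (auto simp: smooth01_deriv_eq[OF smooth])
  then have const: "tree_constant s \<epsilon> = (I / 96) powr (1/3) * ((1 - 2 * \<epsilon>) / 4) powr (2/3)"
    by (simp add: tree_constant_def)
  show "tree_constant s \<epsilon> > 0" unfolding const using I(2) \<epsilon> by simp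
  have I0: "48 * C\<^sup>2 / I \<ge> 0" "1 / \<epsilon> > 0" using I(2) \<epsilon> by auto
  then have k1: "real k > 0" "1 / \<epsilon> \<le> real k" "48 * C\<^sup>2 / I \<le> real k" using k by linarith+
  then have n: "real n > 0" using k by linarith
  have "real k \<ge> 1" using k1(1) by simp
  then have "real k \<le> (real k)\<^sup>2" by (simp add: power2_eq_square)
  then have "48 * C\<^sup>2 / I \<le> (real k)\<^sup>2" using k1(3) by linarith
  then have CI: "48 * C\<^sup>2 \<le> I * (real k)\<^sup>2" using I(2) by (simp add: pos_divide_le_eq mult.commute)
  have "C\<^sup>2 / (2 * real k ^ 4) = 48 * C\<^sup>2 / (96 * real k ^ 4)" by simp
  also have "\<dots> \<le> I * (real k)\<^sup>2 / (96 * real k ^ 4)"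
    using CI by (intro divide_right_mono) auto
  also have "\<dots> = I / 96 / (real k)\<^sup>2" using k1(1) by (simp add: power2_eq_square eval_nat_numeral)
  finally have bias: "C\<^sup>2 / (2 * real k ^ 4) \<le> I / 96 / (real k)\<^sup>2" .
  define b where "b = (1 - 2 * \<epsilon>) / 4 * (\<sigma>\<^sup>2 / real n)"
  have b: "b > 0" using \<epsilon> \<sigma> n by (simp add: b_def)
  have "b powr (2/3) = ((1 - 2 * \<epsilon>) / 4) powr (2/3) * (\<sigma>\<^sup>2 / real n) powr (2/3)"
    unfolding b_def by (rule powr_mult)
  then have "tree_constant s \<epsilon> * (\<sigma>\<^sup>2 / real n) powr (2/3) = (I / 96) powr (1/3) * b powr (2/3)"
    unfolding const by simp
  also have "\<dots> \<le> b * real k + I / 96 / (real k)\<^sup>2"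
    using variance_bias_tradeoff[of "I / 96" b "real k"] I(2) b k1 by simp
  also have "\<dots> \<le> (1 - 2 * \<epsilon>) * \<sigma>\<^sup>2 * real k / (4 * real n) + I / (48 * (real k)\<^sup>2) - C\<^sup>2 / (2 * real k ^ 4)"
  proof -
    have "b * real k = (1 - 2 * \<epsilon>) * \<sigma>\<^sup>2 * real k / (4 * real n)" by (simp add: b_def)
    moreover have "I / (48 * (real k)\<^sup>2) = 2 * (I / 96 / (real k)\<^sup>2)" by simp
    ultimately show ?thesis using bias by linarith
  qed
  finally have "ennreal (tree_constant s \<epsilon> * (\<sigma>\<^sup>2 / real n) powr (2/3)) \<le>
      ennreal ((1 - 2 * \<epsilon>) * \<sigma>\<^sup>2 * real k / (4 * real n) + I / (48 * (real k)\<^sup>2) - C\<^sup>2 / (2 * real k ^ 4))"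
    by (rule ennreal_leI)
  also have "\<dots> \<le> tree_risk P s \<epsilon> n k"
    unfolding I(1) by (rule tree_risk_lower[OF \<epsilon> k1(2) k(2)])
  finally show "ennreal (tree_constant s \<epsilon> * (\<sigma>\<^sup>2 / real n) powr (2/3)) \<le> tree_risk P s \<epsilon> n k" .
qed

theorem mainTheorem10:
  shows
    "(\<exists>(L1 :: real \<Rightarrow> real) (n1 :: real \<Rightarrow> real \<Rightarrow> real \<Rightarrow> real \<Rightarrow> nat).
        \<forall>(s :: real \<Rightarrow> real) s' C2 \<epsilon> \<sigma> P.
          C2 > 0 \<and> smooth01 s s' C2 \<and> 0 < \<epsilon> \<and> \<epsilon> < 1/2 \<and> \<sigma> > 0 \<and> regression_law P s \<sigma> \<longrightarrow>
          (\<forall>n \<ge> n1 (\<sigma>\<^sup>2) \<epsilon> (sup_norm01 s) (sup_norm01 s').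
             (INF k\<in>{k. 1/\<epsilon> \<le> real k \<and> k \<le> n}. forest_risk P s \<epsilon> n k)
               \<le> ennreal (L1 C2 * (\<sigma>\<^sup>2 / real n) powr (4/5))))
   \<and> (\<exists>(k0 :: real \<Rightarrow> real \<Rightarrow> real \<Rightarrow> real \<Rightarrow> nat) (L2 :: (real \<Rightarrow> real) \<Rightarrow> real \<Rightarrow> real)
        (n2 :: real \<Rightarrow> real \<Rightarrow> nat).
        \<forall>(s :: real \<Rightarrow> real) s' C2 \<epsilon> \<sigma> P.
          C2 > 0 \<and> smooth01 s s' C2 \<and> 0 < \<epsilon> \<and> \<epsilon> < 1/2 \<and> \<sigma> > 0 \<and> regression_law P s \<sigma> \<and>
          (LINT x:{\<epsilon>..1-\<epsilon>}|lborel. (s' x)\<^sup>2) > 0 \<longrightarrow>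
          (let K = k0 \<epsilon> (sup_norm01 s') C2 (LINT x:{\<epsilon>..1-\<epsilon>}|lborel. (s' x)\<^sup>2) in
             real K \<ge> 1/\<epsilon> \<and> L2 s \<epsilon> > 0 \<and>
             (\<forall>n \<ge> max (n2 (\<sigma>\<^sup>2) \<epsilon>) K.
                (INF k\<in>{K..n}. tree_risk P s \<epsilon> n k)
                  \<ge> ennreal (L2 s \<epsilon> * (\<sigma>\<^sup>2 / real n) powr (2/3)))))"
proof
  define Q where "Q = (\<lambda>(v::real) (\<epsilon>::real) (a::real) (b::real) N. \<forall>n\<ge>N. n \<ge> 1 \<and>
     (\<exists>k. 1 / \<epsilon> \<le> real k \<and> k \<le> n \<and>
     (\<forall>C. 4 * (v + (b / real k)\<^sup>2) * real k / real n + 2 * C\<^sup>2 / real k ^ 4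
          + 2 * (a + b)\<^sup>2 * exp (- (real n / real k)) \<le> (10 + 2 * C\<^sup>2) * (v / real n) powr (4/5))))"
  define n1 where "n1 = (\<lambda>v \<epsilon> a b. SOME N. Q v \<epsilon> a b N)"
  have n1: "Q v \<epsilon> a b (n1 v \<epsilon> a b)" if "v > 0" "\<epsilon> > 0" for v \<epsilon> a b
    unfolding n1_def Q_def by (rule someI_ex[OF forest_choice[OF that]])
  show "\<exists>(L1 :: real \<Rightarrow> real) (n1 :: real \<Rightarrow> real \<Rightarrow> real \<Rightarrow> real \<Rightarrow> nat).
        \<forall>(s :: real \<Rightarrow> real) s' C2 \<epsilon> \<sigma> P.
          C2 > 0 \<and> smooth01 s s' C2 \<and> 0 < \<epsilon> \<and> \<epsilon> < 1/2 \<and> \<sigma> > 0 \<and> regression_law P s \<sigma> \<longrightarrow>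
          (\<forall>n \<ge> n1 (\<sigma>\<^sup>2) \<epsilon> (sup_norm01 s) (sup_norm01 s').
             (INF k\<in>{k. 1/\<epsilon> \<le> real k \<and> k \<le> n}. forest_risk P s \<epsilon> n k)
               \<le> ennreal (L1 C2 * (\<sigma>\<^sup>2 / real n) powr (4/5)))"
  proof (rule exI[of _ "\<lambda>C. 10 + 2 * C\<^sup>2"], rule exI[of _ n1], intro allI impI, elim conjE)
    fix s s' :: "real \<Rightarrow> real" and C \<epsilon> \<sigma> :: real and P n
    assume smooth: "smooth01 s s' C" and \<epsilon>: "0 < \<epsilon>" "\<epsilon> < 1/2" and \<sigma>: "\<sigma> > 0"
      and law: "regression_law P s \<sigma>" and n: "n1 (\<sigma>\<^sup>2) \<epsilon> (sup_norm01 s) (sup_norm01 s') \<le> n"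
    interpret regression P s s' C \<sigma> by unfold_locales (fact smooth law \<sigma>)+
    have "Q (\<sigma>\<^sup>2) \<epsilon> (sup_norm01 s) (sup_norm01 s') (n1 (\<sigma>\<^sup>2) \<epsilon> (sup_norm01 s) (sup_norm01 s'))"
      using \<sigma> \<epsilon> by (intro n1) auto
    then obtain k where n1: "n \<ge> 1" and k: "1 / \<epsilon> \<le> real k" "k \<le> n"
      and le: "4 * (\<sigma>\<^sup>2 + (sup_norm01 s' / real k)\<^sup>2) * real k / real n + 2 * C\<^sup>2 / real k ^ 4
          + 2 * (sup_norm01 s + sup_norm01 s')\<^sup>2 * exp (- (real n / real k)) \<le> (10 + 2 * C\<^sup>2) * (\<sigma>\<^sup>2 / real n) powr (4/5)"
      unfolding Q_def using n by blast
    have "(INF k\<in>{k. 1/\<epsilon> \<le> real k \<and> k \<le> n}. forest_risk P s \<epsilon> n k) \<le> forest_risk P s \<epsilon> n k"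
      using k by (intro INF_lower) auto
    also have "\<dots> \<le> ennreal ((10 + 2 * C\<^sup>2) * (\<sigma>\<^sup>2 / real n) powr (4/5))"
      by (rule order_trans[OF forest_risk_upper[OF \<epsilon> k(1) n1] ennreal_leI[OF le]])
    finally show "(INF k\<in>{k. 1/\<epsilon> \<le> real k \<and> k \<le> n}. forest_risk P s \<epsilon> n k)
        \<le> ennreal ((10 + 2 * C\<^sup>2) * (\<sigma>\<^sup>2 / real n) powr (4/5))" .
  qed
next
  show "\<exists>(k0 :: real \<Rightarrow> real \<Rightarrow> real \<Rightarrow> real \<Rightarrow> nat) (L2 :: (real \<Rightarrow> real) \<Rightarrow> real \<Rightarrow> real)
        (n2 :: real \<Rightarrow> real \<Rightarrow> nat).
        \<forall>(s :: real \<Rightarrow> real) s' C2 \<epsilon> \<sigma> P.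
          C2 > 0 \<and> smooth01 s s' C2 \<and> 0 < \<epsilon> \<and> \<epsilon> < 1/2 \<and> \<sigma> > 0 \<and> regression_law P s \<sigma> \<and>
          (LINT x:{\<epsilon>..1-\<epsilon>}|lborel. (s' x)\<^sup>2) > 0 \<longrightarrow>
          (let K = k0 \<epsilon> (sup_norm01 s') C2 (LINT x:{\<epsilon>..1-\<epsilon>}|lborel. (s' x)\<^sup>2) in
             real K \<ge> 1/\<epsilon> \<and> L2 s \<epsilon> > 0 \<and>
             (\<forall>n \<ge> max (n2 (\<sigma>\<^sup>2) \<epsilon>) K.
                (INF k\<in>{K..n}. tree_risk P s \<epsilon> n k)
                  \<ge> ennreal (L2 s \<epsilon> * (\<sigma>\<^sup>2 / real n) powr (2/3))))"
    \<comment> \<open>With \<open>I\<close> for the energy, \<open>k \<ge> 48 C\<^sup>2 / I\<close> makes the remainder \<open>C\<^sup>2 / (2 k ^ 4)\<close> at most half of the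
      contribution \<open>I / (48 k\<^sup>2)\<close> of the linear bias.\<close>
  proof (rule exI[of _ "\<lambda>\<epsilon> _ C I. nat \<lceil>1 / \<epsilon> + 48 * C\<^sup>2 / I\<rceil>"], rule exI[of _ tree_constant],
      rule exI[of _ "\<lambda>_ _. 0"], intro allI impI, elim conjE, unfold Let_def, intro conjI allI impI)
    fix s s' :: "real \<Rightarrow> real" and C \<epsilon> \<sigma> :: real and P
    assume smooth: "smooth01 s s' C" and \<epsilon>: "0 < \<epsilon>" "\<epsilon> < 1/2" and \<sigma>: "\<sigma> > 0"
      and law: "regression_law P s \<sigma>" and I: "(LINT x:{\<epsilon>..1-\<epsilon>}|lborel. (s' x)\<^sup>2) > 0"
    let ?K = "nat \<lceil>1 / \<epsilon> + 48 * C\<^sup>2 / (LINT x:{\<epsilon>..1-\<epsilon>}|lborel. (s' x)\<^sup>2)\<rceil>"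
    note lower = tree_lower_bound[OF smooth \<epsilon> \<sigma> law refl I]
    have K: "1 / \<epsilon> + 48 * C\<^sup>2 / (LINT x:{\<epsilon>..1-\<epsilon>}|lborel. (s' x)\<^sup>2) \<le> real ?K"
      by (rule real_nat_ceiling_ge)
    then show "tree_constant s \<epsilon> > 0" by (rule lower(1)) (rule order_refl)
    have "48 * C\<^sup>2 / (LINT x:{\<epsilon>..1-\<epsilon>}|lborel. (s' x)\<^sup>2) \<ge> 0" using I by simp
    then show "1 / \<epsilon> \<le> real ?K" using K by linarith
    fix n
    show "ennreal (tree_constant s \<epsilon> * (\<sigma>\<^sup>2 / real n) powr (2/3)) \<le> (INF k\<in>{?K..n}. tree_risk P s \<epsilon> n k)"
    proof (rule INF_greatest)
      fix k assume "k \<in> {?K..n}"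
      then show "ennreal (tree_constant s \<epsilon> * (\<sigma>\<^sup>2 / real n) powr (2/3)) \<le> tree_risk P s \<epsilon> n k"
        using K by (intro lower(2)) auto
    qed
  qed
qed

end
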